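(* Let $\bar{\mathcal{S}}^0=\mathrm{Lie}(S)$ be the annihilation superalgebra of the Lie conformal superalgebra $S$. Then $\bar{\mathcal{S}}^0$ has a basis $\{L_m,W_m,G_m : m\in\mathbb{Z}\}$, i.e. $\bar{\mathcal{S}}^0=\bigoplus_{m\in\mathbb{Z}}(\mathbb{C}L_m\oplus\mathbb{C}W_m\oplus\mathbb{C}G_m)$, with $L_m,W_m$ even and $G_m$ odd, satisfying for all $m,n\in\mathbb{Z}$ $$[L_m,L_n]=(n-m)L_{m+n},\quad [L_m,W_n]=(m+n)W_{m+n},\quad [L_m,G_n]=nG_{m+n},$$ $$[G_m,G_n]=(m+n)W_{m+n},\quad [W_m,W_n]=[W_m,G_n]=0.$$
   Context: Everything is over $\mathbb{C}$. A Lie conformal superalgebra $R=R_{\bar0}\oplus R_{\bar1}$ is a $\mathbb{Z}_2$-graded $\mathbb{C}[\partial]$-module with a $\mathbb{C}$-linear $\lambda$-bracket $R\otimes R\to\mathbb{C}[\lambda]\otimes R$, $a\otimes b\mapsto[a_\lambda b]$, satisfying conformal sesquilinearity $[\partial a_\lambda b]=-\lambda[a_\lambda b]$, $[a_\lambda\partial b]=(\partial+\lambda)[a_\lambda b]$; super skew-symmetry $[a_\lambda b]=-(-1)^{|a||b|}[b_{-\lambda-\partial}a]$; and the super Jacobi identity $[a_\lambda[b_\mu c]]=[[a_\lambda b]_{\lambda+\mu}c]+(-1)^{|a||b|}[b_\mu[a_\lambda c]]$. $S=S_{\bar0}\oplus S_{\bar1}$ is the free $\mathbb{Z}_2$-graded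 $\mathbb{C}[\partial]$-module with $S_{\bar0}=\mathbb{C}[\partial]L\oplus\mathbb{C}[\partial]W$, $S_{\bar1}=\mathbb{C}[\partial]G$ and non-trivial $\lambda$-brackets $[L_\lambda L]=(\partial+2\lambda)L$, $[L_\lambda W]=\partial W$, $[L_\lambda G]=(\partial+\lambda)G$, $[G_\lambda G]=\partial W$ (the brackets $[W_\lambda W]$ and $[W_\lambda G]$ vanish, and the remaining ones are determined by skew-symmetry). Write $[a_\lambda b]=\sum_{j\ge0}\frac{\lambda^j}{j!}a_{(j)}b$. The annihilation superalgebra $\mathrm{Lie}(R)$ is the Lie superalgebra spanned over $\mathbb{C}$ by symbols $a_{(n)}$ ($a\in R$, $n\in\mathbb{Z}$) subject to the relations $(\partial a)_{(n)}=-na_{(n-1)}$, $(a+b)_{(n)}=a_{(n)}+b_{(n)}$, $(ka)_{(n)}=ka_{(n)}$ ($k\in\mathbb{C}$), with $|a_{(n)}|=|a|$ and bracket $[a_{(m)},b_{(n)}]=\sum_{j\ge0}\binom{m}{j}(a_{(j)}b)_{(m+n-j)}$. *)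

theory Defs
  imports
    "HOL-Computational_Algebra.Polynomial"
    "HOL-Computational_Algebra.Formal_Power_Series"
    "HOL-Library.Poly_Mapping"
    "HOL-Library.Z2"
    Complex_Main
begin

section \<open>Complex vector spaces and superspaces\<close>

class complex_vector = ab_group_add +
  fixes scaleC :: "complex \<Rightarrow> 'a \<Rightarrow> 'a" (infixr \<open>*\<^sub>C\<close> 75)
  assumes scaleC_add_right: "c *\<^sub>C (x + y) = c *\<^sub>C x + c *\<^sub>C y"
    and scaleC_add_left: "(c + d) *\<^sub>C x = c *\<^sub>C x + d *\<^sub>C x"
    and scaleC_scaleC: "c *\<^sub>C d *\<^sub>C x = (c * d) *\<^sub>C x"
    and scaleC_one: "1 *\<^sub>C x = x"

global_interpretation cvec: vector_space "scaleC :: complex \<Rightarrow> 'a \<Rightarrow> 'a::complex_vector"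
  defines csubspace = cvec.subspace
    and cspan = cvec.span
    and cdependent = cvec.dependent
  by (rule vector_space.intro) (rule scaleC_add_right scaleC_add_left scaleC_scaleC scaleC_one)+

abbreviation clinear :: "('a::complex_vector \<Rightarrow> 'b::complex_vector) \<Rightarrow> bool"
  where "clinear \<equiv> module_hom scaleC scaleC"

instantiation complex :: complex_vector
begin
definition scaleC_complex :: "complex \<Rightarrow> complex \<Rightarrow> complex" where "scaleC_complex = (*)"
instance by standard (auto simp: scaleC_complex_def algebra_simps)
end

instantiation poly_mapping :: (type, complex_vector) complex_vector
begin
definition scaleC_poly_mapping :: "complex \<Rightarrow> ('a \<Rightarrow>\<^sub>0 'b) \<Rightarrow> ('a \<Rightarrow>\<^sub>0 'b)"
  where "scaleC_poly_mapping c = Poly_Mapping.map (scaleC c)"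

lemma lookup_scaleC:
  "Poly_Mapping.lookup (c *\<^sub>C f) k = c *\<^sub>C Poly_Mapping.lookup (f :: 'a \<Rightarrow>\<^sub>0 'b) k"
  by (simp add: scaleC_poly_mapping_def Poly_Mapping.map.rep_eq when_def)

instance
  by standard (rule poly_mapping_eqI, simp add: lookup_scaleC lookup_add
      scaleC_add_right scaleC_add_left scaleC_scaleC scaleC_one)+

end

text \<open>The degree of a homogeneous vector lies in \<open>\<int>/2\<close>, represented by the type \<^typ>\<open>bit\<close>.\<close>

class super_vector = complex_vector +
  fixes homog :: "bit \<Rightarrow> 'a set"
  assumes homog_zero: "0 \<in> homog i"
    and homog_add: "x \<in> homog i \<Longrightarrow> y \<in> homog i \<Longrightarrow> x + y \<in> homog i"
    and homog_scale: "x \<in> homog i \<Longrightarrow> c *\<^sub>C x \<in> homog i"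
    and homog_Int: "homog 0 \<inter> homog 1 = {0}"
    and homog_sum: "\<exists>y\<in>homog 0. \<exists>z\<in>homog 1. x = y + z"

definition koszul :: "bit \<Rightarrow> bit \<Rightarrow> complex"  \<comment> \<open>the sign \<open>(-1)\<^bsup>ij\<^esup>\<close>\<close>
  where "koszul i j = (if i * j = 1 then -1 else 1)"

section \<open>Lie superalgebras\<close>

class lie_superalgebra = super_vector +
  fixes lie :: "'a \<Rightarrow> 'a \<Rightarrow> 'a"
  assumes lie_add_left: "lie (x + y) z = lie x z + lie y z"
    and lie_add_right: "lie x (y + z) = lie x y + lie x z"
    and lie_scale_left: "lie (c *\<^sub>C x) y = c *\<^sub>C lie x y"
    and lie_scale_right: "lie x (c *\<^sub>C y) = c *\<^sub>C lie x y"
    and lie_homog: "x \<in> homog i \<Longrightarrow> y \<in> homog j \<Longrightarrow> lie x y \<in> homog (i + j)"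
    and lie_skew: "x \<in> homog i \<Longrightarrow> y \<in> homog j \<Longrightarrow> lie x y = - (koszul i j *\<^sub>C lie y x)"
    and lie_jacobi: "x \<in> homog i \<Longrightarrow> y \<in> homog j \<Longrightarrow>
      lie x (lie y z) = lie (lie x y) z + koszul i j *\<^sub>C lie y (lie x z)"

section \<open>Lie conformal superalgebras\<close>

text \<open>
  \<open>lbr a b j\<close> is the coefficient of \<open>\<lambda>\<^sup>j\<close> in \<open>[a\<^sub>\<lambda> b]\<close>, an element of \<open>\<complex>[\<lambda>] \<otimes> R\<close>, that is, a
  finitely supported sequence in \<open>R\<close>.  \<open>lbr_at a l b\<close> is the value of \<open>[a\<^sub>\<lambda> b]\<close> at \<open>\<lambda> = l\<close>.
  Since \<open>\<complex>\<close> is infinite, an identity between polynomials in \<open>\<lambda>\<close> (or in \<open>\<lambda>, \<mu>\<close>) with coefficients in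
  \<open>R\<close> holds if and only if it holds for all complex values of the variables, and it is in this form
  that the axioms are given.
\<close>

class lambda_bracket = super_vector +
  fixes del :: "'a \<Rightarrow> 'a"
    and lbr :: "'a \<Rightarrow> 'a \<Rightarrow> nat \<Rightarrow> 'a"
  assumes finite_lbr: "finite {j. lbr a b j \<noteq> 0}"
begin

definition lbr_at :: "'a \<Rightarrow> complex \<Rightarrow> 'a \<Rightarrow> 'a"
  where "lbr_at a l b = (\<Sum>j | lbr a b j \<noteq> 0. l ^ j *\<^sub>C lbr a b j)"

text \<open>The value at \<open>\<lambda> = l\<close> of \<open>[a\<^bsub>-\<lambda>-\<partial>\<^esub> b]\<close>, with the powers of \<open>-\<lambda>-\<partial>\<close> acting on the coefficients.\<close>

definition lbr_at_skew :: "'a \<Rightarrow> complex \<Rightarrow> 'a \<Rightarrow> 'a"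
  where "lbr_at_skew a l b =
    (\<Sum>j | lbr a b j \<noteq> 0. ((\<lambda>x. - (l *\<^sub>C x) - del x) ^^ j) (lbr a b j))"

end

class lie_conformal_superalgebra = lambda_bracket +
  assumes del_add: "del (a + b) = del a + del b"
    and del_scale: "del (k *\<^sub>C a) = k *\<^sub>C del a"
    and del_homog: "a \<in> homog i \<Longrightarrow> del a \<in> homog i"
    and lbr_homog: "a \<in> homog i \<Longrightarrow> b \<in> homog j \<Longrightarrow> lbr a b n \<in> homog (i + j)"
    and lbr_add_left: "lbr (a + b) c n = lbr a c n + lbr b c n"
    and lbr_add_right: "lbr a (b + c) n = lbr a b n + lbr a c n"
    and lbr_scale_left: "lbr (k *\<^sub>C a) b n = k *\<^sub>C lbr a b n"
    and lbr_scale_right: "lbr a (k *\<^sub>C b) n = k *\<^sub>C lbr a b n"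
    and lbr_del_left: "lbr_at (del a) l b = - l *\<^sub>C lbr_at a l b"
    and lbr_del_right: "lbr_at a l (del b) = del (lbr_at a l b) + l *\<^sub>C lbr_at a l b"
    and lbr_skew: "a \<in> homog i \<Longrightarrow> b \<in> homog j \<Longrightarrow>
      lbr_at a l b = - (koszul i j *\<^sub>C lbr_at_skew b l a)"
    and lbr_jacobi: "a \<in> homog i \<Longrightarrow> b \<in> homog j \<Longrightarrow>
      lbr_at a l (lbr_at b m c) =
        lbr_at (lbr_at a l b) (l + m) c + koszul i j *\<^sub>C lbr_at b m (lbr_at a l c)"

definition nprod :: "'a::lie_conformal_superalgebra \<Rightarrow> nat \<Rightarrow> 'a \<Rightarrow> 'a"
  \<comment> \<open>\<open>a\<^sub>(\<^sub>j\<^sub>)b\<close>, where \<open>[a\<^sub>\<lambda> b] = (\<Sum>j. \<lambda>\<^sup>j / j! a\<^sub>(\<^sub>j\<^sub>)b)\<close>\<close>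
  where "nprod a j b = fact j *\<^sub>C lbr a b j"

section \<open>The conformal superalgebra \<open>S\<close>\<close>

text \<open>\<open>Elt p q r\<close> is \<open>p(\<partial>) L + q(\<partial>) W + r(\<partial>) G\<close>.\<close>

datatype S = Elt (cL: "complex poly") (cW: "complex poly") (cG: "complex poly")

definition S_L :: S where "S_L = Elt 1 0 0"
definition S_W :: S where "S_W = Elt 0 1 0"
definition S_G :: S where "S_G = Elt 0 0 1"

text \<open>
  Elements of \<open>\<complex>[\<partial>][\<lambda>]\<close> are of type \<^typ>\<open>complex poly poly\<close>, the outer variable being \<open>\<lambda>\<close>.
  \<open>subst_at p e\<close> is \<open>p(e)\<close> for \<open>p\<close> with constant coefficients and \<open>e\<close> in \<open>\<complex>[\<partial>][\<lambda>]\<close>.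
\<close>

abbreviation (input) var_lambda :: "complex poly poly" where "var_lambda \<equiv> [:0, 1:]"
abbreviation (input) var_del :: "complex poly poly" where "var_del \<equiv> [:[:0, 1:]:]"

definition subst_at :: "complex poly \<Rightarrow> complex poly poly \<Rightarrow> complex poly poly"
  where "subst_at p e = poly (map_poly (\<lambda>c. [:[:c:]:]) p) e"

text \<open>
  The brackets of generators, extended by
  \<open>[p(\<partial>) x\<^sub>\<lambda> q(\<partial>) y] = p(-\<lambda>) q(\<partial>+\<lambda>) [x\<^sub>\<lambda> y]\<close>.  Besides the given ones they include
  \<open>[W\<^sub>\<lambda> L] = -\<partial>W\<close> and \<open>[G\<^sub>\<lambda> L] = \<lambda>G\<close>, which skew-symmetry forces.
\<close>

definition S_bracket_L :: "S \<Rightarrow> S \<Rightarrow> complex poly poly"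
  where "S_bracket_L a b =
    subst_at (cL a) (- var_lambda) * subst_at (cL b) (var_del + var_lambda) * (var_del + 2 * var_lambda)"

definition S_bracket_W :: "S \<Rightarrow> S \<Rightarrow> complex poly poly"
  where "S_bracket_W a b =
      subst_at (cL a) (- var_lambda) * subst_at (cW b) (var_del + var_lambda) * var_del
    - subst_at (cW a) (- var_lambda) * subst_at (cL b) (var_del + var_lambda) * var_del
    + subst_at (cG a) (- var_lambda) * subst_at (cG b) (var_del + var_lambda) * var_del"

definition S_bracket_G :: "S \<Rightarrow> S \<Rightarrow> complex poly poly"
  where "S_bracket_G a b =
      subst_at (cL a) (- var_lambda) * subst_at (cG b) (var_del + var_lambda) * (var_del + var_lambda)
    + subst_at (cG a) (- var_lambda) * subst_at (cL b) (var_del + var_lambda) * var_lambda"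

instantiation S :: complex_vector
begin
definition zero_S :: S where "0 = Elt 0 0 0"
definition plus_S :: "S \<Rightarrow> S \<Rightarrow> S" where "a + b = Elt (cL a + cL b) (cW a + cW b) (cG a + cG b)"
definition minus_S :: "S \<Rightarrow> S \<Rightarrow> S" where "a - b = Elt (cL a - cL b) (cW a - cW b) (cG a - cG b)"
definition uminus_S :: "S \<Rightarrow> S" where "- a = Elt (- cL a) (- cW a) (- cG a)"
definition scaleC_S :: "complex \<Rightarrow> S \<Rightarrow> S"
  where "c *\<^sub>C a = Elt (smult c (cL a)) (smult c (cW a)) (smult c (cG a))"
instance
  by standard
    (auto simp: zero_S_def plus_S_def minus_S_def uminus_S_def scaleC_S_def
       smult_add_right smult_add_left)
end

lemma S_sel [simp]:
  "cL 0 = 0" "cW 0 = 0" "cG 0 = 0"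
  "cL (a + b) = cL a + cL b" "cW (a + b) = cW a + cW b" "cG (a + b) = cG a + cG b"
  "cL (a - b) = cL a - cL b" "cW (a - b) = cW a - cW b" "cG (a - b) = cG a - cG b"
  "cL (- a) = - cL a" "cW (- a) = - cW a" "cG (- a) = - cG a"
  "cL (c *\<^sub>C a) = smult c (cL a)" "cW (c *\<^sub>C a) = smult c (cW a)" "cG (c *\<^sub>C a) = smult c (cG a)"
  by (simp_all add: zero_S_def plus_S_def minus_S_def uminus_S_def scaleC_S_def)

lemma S_sel_sum [simp]:
  "cL (sum f A) = (\<Sum>x\<in>A. cL (f x))"
  "cW (sum f A) = (\<Sum>x\<in>A. cW (f x))"
  "cG (sum f A) = (\<Sum>x\<in>A. cG (f x))"
  by (induction A rule: infinite_finite_induct) auto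

instantiation S :: super_vector
begin
definition homog_S :: "bit \<Rightarrow> S set"
  where "homog_S i = (if i = 0 then {a. cG a = 0} else {a. cL a = 0 \<and> cW a = 0})"
instance proof
  fix x :: S
  have "Elt (cL x) (cW x) 0 \<in> homog 0" "Elt 0 0 (cG x) \<in> homog 1"
    "x = Elt (cL x) (cW x) 0 + Elt 0 0 (cG x)"
    by (simp_all add: homog_S_def S.expand)
  then show "\<exists>y\<in>homog 0. \<exists>z\<in>homog 1. x = y + z" by blast
qed (auto simp: homog_S_def S.expand)
end

instantiation S :: lambda_bracket
begin
definition del_S :: "S \<Rightarrow> S"
  where "del a = Elt ([:0, 1:] * cL a) ([:0, 1:] * cW a) ([:0, 1:] * cG a)"
definition lbr_S :: "S \<Rightarrow> S \<Rightarrow> nat \<Rightarrow> S"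
  where "lbr a b j = Elt (coeff (S_bracket_L a b) j) (coeff (S_bracket_W a b) j) (coeff (S_bracket_G a b) j)"
instance proof
  fix a b :: S
  have "{j. lbr a b j \<noteq> 0} \<subseteq>
     {j. coeff (S_bracket_L a b) j \<noteq> 0} \<union> {j. coeff (S_bracket_W a b) j \<noteq> 0} \<union> {j. coeff (S_bracket_G a b) j \<noteq> 0}"
    by (auto simp: lbr_S_def zero_S_def)
  moreover have "finite {j. coeff p j \<noteq> 0}" for p :: "complex poly poly"
    using MOST_coeff_eq_0[of p] by (simp add: MOST_iff_cofinite)
  ultimately show "finite {j. lbr a b j \<noteq> 0}"
    by (meson finite_Un finite_subset)
qed
end

lemma subst_at_poly:
  "poly (poly (subst_at p e) y) x = poly p (poly (poly e y) x)"
  unfolding subst_at_def by (induction p) (simp_all add: map_poly_pCons algebra_simps)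

lemma subst_at_hom:
  "subst_at 0 e = 0" "subst_at 1 e = 1"
  "subst_at (p + q) e = subst_at p e + subst_at q e"
  "subst_at (smult k p) e = smult [:k:] (subst_at p e)"
proof -
  show "subst_at 0 e = 0" "subst_at 1 e = 1"
    by (simp_all add: subst_at_def map_poly_pCons one_pCons)
  have *: "u = v" if "\<And>y x. poly (poly u y) x = poly (poly v y) x" for u v :: "complex poly poly"
    using that by (metis poly_eqI2 poly_eq_poly_eq_iff ext)
  show "subst_at (p + q) e = subst_at p e + subst_at q e"
    by (rule *) (simp add: subst_at_poly)
  show "subst_at (smult k p) e = smult [:k:] (subst_at p e)"
    by (rule *) (simp add: subst_at_poly)
qed

lemma sum_support_bound:
  fixes f :: "nat \<Rightarrow> 'a::zero" and g :: "nat \<Rightarrow> 'a \<Rightarrow> 'b::comm_monoid_add"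
  assumes "\<And>j. j \<ge> N \<Longrightarrow> f j = 0" "\<And>j. g j 0 = 0"
  shows "(\<Sum>j | f j \<noteq> 0. g j (f j)) = (\<Sum>j<N. g j (f j))"
  by (rule sum.mono_neutral_left) (use assms in \<open>auto simp: subset_iff simp flip: not_le\<close>)

lemma lbr_bound: "\<exists>N. \<forall>j\<ge>N. lbr a b j = (0::'a::lambda_bracket)"
  using finite_lbr[of a b] by (metis (mono_tags, lifting) finite_nat_set_iff_bounded mem_Collect_eq not_le)

lemma lbr_at_bound:
  fixes a b :: "'a::lambda_bracket"
  assumes "\<And>j. j \<ge> N \<Longrightarrow> lbr a b j = 0"
  shows "lbr_at a l b = (\<Sum>j<N. l ^ j *\<^sub>C lbr a b j)"
  unfolding lbr_at_def by (rule sum_support_bound) (use assms in auto)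

lemma lbr_at_skew_bound:
  fixes a b :: "'a::lambda_bracket"
  assumes "\<And>j. j \<ge> N \<Longrightarrow> lbr a b j = 0" "del (0::'a) = 0"
  shows "lbr_at_skew a l b = (\<Sum>j<N. ((\<lambda>x. - (l *\<^sub>C x) - del x) ^^ j) (lbr a b j))"
proof -
  have "((\<lambda>x. - (l *\<^sub>C x) - del x) ^^ j) (0::'a) = 0" for j
    by (induction j) (simp_all add: assms(2))
  then show ?thesis
    unfolding lbr_at_skew_def by (intro sum_support_bound) (use assms in auto)
qed

lemma poly_poly_bound:
  fixes P :: "complex poly poly"
  assumes "\<And>j. j \<ge> N \<Longrightarrow> coeff P j = 0"
  shows "poly (poly P [:y:]) x = (\<Sum>j<N. y ^ j * poly (coeff P j) x)"
proof -
  have "poly P [:y:] = (\<Sum>j\<le>degree P. coeff P j * [:y:] ^ j)"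
    by (rule poly_altdef)
  also have "\<dots> = (\<Sum>j<N. coeff P j * [:y:] ^ j)"
    by (rule sum.mono_neutral_cong)
      (use assms coeff_eq_0[of P] in \<open>auto simp flip: not_le\<close>)
  finally show ?thesis
    by (simp add: poly_sum mult.commute)
qed

lemma S_lbr_bound:
  fixes a b :: S
  assumes "\<And>j. j \<ge> N \<Longrightarrow> lbr a b j = 0" and "j \<ge> N"
  shows "coeff (S_bracket_L a b) j = 0" "coeff (S_bracket_W a b) j = 0" "coeff (S_bracket_G a b) j = 0"
  using assms(1)[OF assms(2)] by (simp_all add: lbr_S_def zero_S_def)

lemma S_lbr_at:
  fixes a b :: S
  shows "poly (cL (lbr_at a l b)) x = poly (poly (S_bracket_L a b) [:l:]) x"
    and "poly (cW (lbr_at a l b)) x = poly (poly (S_bracket_W a b) [:l:]) x"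
    and "poly (cG (lbr_at a l b)) x = poly (poly (S_bracket_G a b) [:l:]) x"
proof -
  obtain N where N: "\<And>j. j \<ge> N \<Longrightarrow> lbr a b j = 0"
    using lbr_bound[of a b] by blast
  note * = S_lbr_bound[OF N]
  show "poly (cL (lbr_at a l b)) x = poly (poly (S_bracket_L a b) [:l:]) x"
    and "poly (cW (lbr_at a l b)) x = poly (poly (S_bracket_W a b) [:l:]) x"
    and "poly (cG (lbr_at a l b)) x = poly (poly (S_bracket_G a b) [:l:]) x"
    by (simp_all add: lbr_at_bound[OF N] poly_poly_bound[OF *(1)] poly_poly_bound[OF *(2)]
        poly_poly_bound[OF *(3)] lbr_S_def poly_sum)
qed

lemma S_del_0: "del (0::S) = 0"
  by (simp add: del_S_def zero_S_def)

lemma S_lbr_at_skew: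
  fixes a b :: S
  shows "poly (cL (lbr_at_skew a l b)) x = poly (poly (S_bracket_L a b) [:- l - x:]) x"
    and "poly (cW (lbr_at_skew a l b)) x = poly (poly (S_bracket_W a b) [:- l - x:]) x"
    and "poly (cG (lbr_at_skew a l b)) x = poly (poly (S_bracket_G a b) [:- l - x:]) x"
proof -
  obtain N where N: "\<And>j. j \<ge> N \<Longrightarrow> lbr a b j = 0"
    using lbr_bound[of a b] by blast
  note * = S_lbr_bound[OF N]
  have pow: "poly (cL (((\<lambda>x. - (l *\<^sub>C x) - del x) ^^ j) v)) x = (- l - x) ^ j * poly (cL v) x"
    "poly (cW (((\<lambda>x. - (l *\<^sub>C x) - del x) ^^ j) v)) x = (- l - x) ^ j * poly (cW v) x"
    "poly (cG (((\<lambda>x. - (l *\<^sub>C x) - del x) ^^ j) v)) x = (- l - x) ^ j * poly (cG v) x" for j v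
    by (induction j) (simp_all add: del_S_def algebra_simps)
  show "poly (cL (lbr_at_skew a l b)) x = poly (poly (S_bracket_L a b) [:- l - x:]) x"
    and "poly (cW (lbr_at_skew a l b)) x = poly (poly (S_bracket_W a b) [:- l - x:]) x"
    and "poly (cG (lbr_at_skew a l b)) x = poly (poly (S_bracket_G a b) [:- l - x:]) x"
    by (simp_all add: lbr_at_skew_bound[OF N S_del_0] poly_poly_bound[OF *(1)]
        poly_poly_bound[OF *(2)] poly_poly_bound[OF *(3)] poly_sum pow) (simp_all add: lbr_S_def)
qed

lemma S_eqI:
  assumes "\<And>x. poly (cL a) x = poly (cL b) x" "\<And>x. poly (cW a) x = poly (cW b) x"
    "\<And>x. poly (cG a) x = poly (cG b) x"
  shows "a = b"
  by (rule S.expand) (use assms in \<open>simp add: poly_eq_poly_eq_iff[symmetric] fun_eq_iff\<close>)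

lemmas S_bracket_defs = S_bracket_L_def S_bracket_W_def S_bracket_G_def

lemma S_bracket_hom:
  "S_bracket_L (a + b) c = S_bracket_L a c + S_bracket_L b c"
  "S_bracket_W (a + b) c = S_bracket_W a c + S_bracket_W b c"
  "S_bracket_G (a + b) c = S_bracket_G a c + S_bracket_G b c"
  "S_bracket_L a (b + c) = S_bracket_L a b + S_bracket_L a c"
  "S_bracket_W a (b + c) = S_bracket_W a b + S_bracket_W a c"
  "S_bracket_G a (b + c) = S_bracket_G a b + S_bracket_G a c"
  "S_bracket_L (k *\<^sub>C a) c = smult [:k:] (S_bracket_L a c)"
  "S_bracket_W (k *\<^sub>C a) c = smult [:k:] (S_bracket_W a c)"
  "S_bracket_G (k *\<^sub>C a) c = smult [:k:] (S_bracket_G a c)"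
  "S_bracket_L a (k *\<^sub>C c) = smult [:k:] (S_bracket_L a c)"
  "S_bracket_W a (k *\<^sub>C c) = smult [:k:] (S_bracket_W a c)"
  "S_bracket_G a (k *\<^sub>C c) = smult [:k:] (S_bracket_G a c)"
  unfolding S_bracket_defs S_sel subst_at_hom
  by (simp_all only: algebra_simps mult_smult_left mult_smult_right smult_add_right smult_diff_right)

instance S :: lie_conformal_superalgebra
proof
  fix a b c :: S and i j :: bit and k l m :: complex and n :: nat
  show "del (a + b) = del a + del b" "del (k *\<^sub>C a) = k *\<^sub>C del a"
    by (auto simp: del_S_def intro!: S.expand)
  show "del a \<in> homog i" if "a \<in> homog i"
    using that by (auto simp: del_S_def homog_S_def split: if_splits)
  show "lbr a b n \<in> homog (i + j)" if "a \<in> homog i" "b \<in> homog j"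
    using that
    by (cases i; cases j)
      (simp_all add: homog_S_def lbr_S_def S_bracket_defs subst_at_hom)
  show "lbr (a + b) c n = lbr a c n + lbr b c n" "lbr a (b + c) n = lbr a b n + lbr a c n"
    "lbr (k *\<^sub>C a) b n = k *\<^sub>C lbr a b n" "lbr a (k *\<^sub>C b) n = k *\<^sub>C lbr a b n"
    by (simp_all add: lbr_S_def S_bracket_hom S.expand)
  show "lbr_at (del a) l b = - l *\<^sub>C lbr_at a l b"
    by (rule S_eqI; simp add: S_lbr_at; simp add: S_bracket_defs subst_at_poly del_S_def; algebra)
  show "lbr_at a l (del b) = del (lbr_at a l b) + l *\<^sub>C lbr_at a l b"
    by (rule S_eqI; simp add: S_lbr_at del_S_def;
        simp add: S_bracket_defs subst_at_poly del_S_def; algebra)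
  show "lbr_at a l b = - (koszul i j *\<^sub>C lbr_at_skew b l a)" if "a \<in> homog i" "b \<in> homog j"
    using that
    by (cases i; cases j; intro S_eqI; simp add: S_lbr_at S_lbr_at_skew koszul_def homog_S_def;
        simp add: S_bracket_defs subst_at_poly subst_at_hom algebra_simps)
  show "lbr_at a l (lbr_at b m c) =
        lbr_at (lbr_at a l b) (l + m) c + koszul i j *\<^sub>C lbr_at b m (lbr_at a l c)"
    if "a \<in> homog i" "b \<in> homog j"
    using that
    by (cases i; cases j; intro S_eqI; simp add: S_lbr_at koszul_def homog_S_def;
        simp add: S_bracket_defs subst_at_poly subst_at_hom S_lbr_at algebra_simps)
qed

lemma S_lambda_brackets:
  "lbr_at S_L l S_L = del S_L + (2 * l) *\<^sub>C S_L"
  "lbr_at S_L l S_W = del S_W"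
  "lbr_at S_L l S_G = del S_G + l *\<^sub>C S_G"
  "lbr_at S_G l S_G = del S_W"
  "lbr_at S_W l S_W = 0"
  "lbr_at S_W l S_G = 0"
  by (rule S_eqI;
      simp add: S_lbr_at S_bracket_defs subst_at_poly subst_at_hom del_S_def S_L_def S_W_def S_G_def)+

section \<open>The annihilation superalgebra\<close>

subsection \<open>Coefficient form of the axioms\<close>

lemma coeffs_eqI:
  fixes f g :: "nat \<Rightarrow> 'a::complex_vector"
  assumes eq: "\<And>l. (\<Sum>j<N. l ^ j *\<^sub>C f j) = (\<Sum>j<N. l ^ j *\<^sub>C g j)" and j: "j < N"
  shows "f j = g j"
proof (rule ccontr)
  assume "f j \<noteq> g j"
  define h where "h = (\<lambda>j. f j - g j)"
  interpret vector_space_pair "scaleC :: complex \<Rightarrow> 'a \<Rightarrow> 'a" "scaleC :: complex \<Rightarrow> complex \<Rightarrow> complex"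
    by unfold_locales
  have "\<not> cdependent {h j}"
    using \<open>f j \<noteq> g j\<close> by (simp add: h_def)
  then have "\<not> module.dependent scaleC {h j}"
    by (simp add: cdependent_def)
  from linear_independent_extend[OF this, of "\<lambda>_. 1"]
  obtain \<phi> where \<phi>: "Vector_Spaces.linear scaleC scaleC \<phi>" "\<phi> (h j) = (1::complex)"
    by auto
  then interpret \<phi>: module_hom scaleC scaleC \<phi>
    by (simp add: linear_iff_module_hom)
  define p where "p = (\<Sum>j<N. monom (\<phi> (h j)) j)"
  have "poly p l = 0" for l
  proof -
    have "poly p l = \<phi> (\<Sum>j<N. l ^ j *\<^sub>C h j)"
      by (simp add: p_def poly_sum poly_monom \<phi>.sum \<phi>.scale scaleC_complex_def mult.commute)
    also have "(\<Sum>j<N. l ^ j *\<^sub>C h j) = 0"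
      using eq[of l] by (simp add: h_def cvec.scale_right_diff_distrib sum_subtractf)
    finally show ?thesis by (simp add: \<phi>.zero)
  qed
  then have "p = 0" using poly_all_0_iff_0 by blast
  then have "coeff p j = 0" by simp
  moreover have "coeff p j = \<phi> (h j)"
    using j by (simp add: p_def coeff_sum if_distrib sum.delta cong: if_cong)
  ultimately show False using \<phi>(2) by simp
qed

context
  fixes a b c :: "'a::lie_conformal_superalgebra"
begin

lemma module_hom_del: "clinear (del :: 'a \<Rightarrow> 'a)"
  by unfold_locales (simp_all add: del_add del_scale)

lemma module_hom_lbr_left: "clinear (\<lambda>a::'a. lbr a b n)"
  and module_hom_lbr_right: "clinear (\<lambda>b::'a. lbr a b n)"
  by (unfold_locales; simp add: lbr_add_left lbr_scale_left lbr_add_right lbr_scale_right)+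

lemmas del_zero [simp] = module_hom.zero[OF module_hom_del]
  and del_sum = module_hom.sum[OF module_hom_del]
  and del_neg = module_hom.neg[OF module_hom_del]
  and lbr_zero_left [simp] = module_hom.zero[OF module_hom_lbr_left]
  and lbr_zero_right [simp] = module_hom.zero[OF module_hom_lbr_right]
  and lbr_sum_left = module_hom.sum[OF module_hom_lbr_left]
  and lbr_sum_right = module_hom.sum[OF module_hom_lbr_right]

end

context
  fixes a b c :: "'a::lie_conformal_superalgebra"
begin

lemma lbr_eventually_0: "\<forall>\<^sub>F k in sequentially. lbr x y k = (0::'a)"
  using lbr_bound[of x y] by (simp add: eventually_sequentially)

lemma lbr_bound2: "\<exists>N. (\<forall>j\<ge>N. lbr x y j = (0::'a)) \<and> (\<forall>j\<ge>N. lbr u v j = (0::'a))"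
proof -
  have "\<forall>\<^sub>F k in sequentially. lbr x y k = 0 \<and> lbr u v k = 0"
    by (intro eventually_conj lbr_eventually_0)
  then show ?thesis
    unfolding eventually_sequentially by blast
qed

lemma sum_pow_shift:
  fixes f :: "nat \<Rightarrow> 'a"
  shows "l *\<^sub>C (\<Sum>j<N. l ^ j *\<^sub>C f j) = (\<Sum>j<Suc N. l ^ j *\<^sub>C (if j = 0 then 0 else f (j - 1)))"
  by (simp add: sum.lessThan_Suc_shift cvec.scale_sum_right del: sum.lessThan_Suc)

lemma lbr_del_left_coeff: "lbr (del a) b j = - (if j = 0 then 0 else lbr a b (j - 1))"
proof -
  obtain N where N: "\<forall>j\<ge>N. lbr a b j = 0" "\<forall>j\<ge>N. lbr (del a) b j = 0"
    using lbr_bound2[of a b "del a" b] by blast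
  show ?thesis
  proof (cases "j < Suc N")
    case True
    show ?thesis
    proof (rule coeffs_eqI[OF _ True])
      fix l
      have "(\<Sum>j<Suc N. l ^ j *\<^sub>C lbr (del a) b j) = lbr_at (del a) l b"
        by (rule lbr_at_bound[symmetric]) (simp add: N)
      also have "\<dots> = - l *\<^sub>C (\<Sum>j<N. l ^ j *\<^sub>C lbr a b j)"
        by (simp add: lbr_del_left lbr_at_bound[of N a b] N)
      also have "\<dots> = (\<Sum>j<Suc N. l ^ j *\<^sub>C - (if j = 0 then 0 else lbr a b (j - 1)))"
        unfolding cvec.scale_minus_left cvec.scale_minus_right sum_negf sum_pow_shift ..
      finally show "(\<Sum>j<Suc N. l ^ j *\<^sub>C lbr (del a) b j) = \<dots>" .
    qed
  next
    case False
    then show ?thesis by (simp add: N)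
  qed
qed

lemma lbr_del_right_coeff: "lbr a (del b) j = del (lbr a b j) + (if j = 0 then 0 else lbr a b (j - 1))"
proof -
  obtain N where N: "\<forall>j\<ge>N. lbr a b j = 0" "\<forall>j\<ge>N. lbr a (del b) j = 0"
    using lbr_bound2[of a b a "del b"] by blast
  show ?thesis
  proof (cases "j < Suc N")
    case True
    show ?thesis
    proof (rule coeffs_eqI[OF _ True])
      fix l
      have "(\<Sum>j<Suc N. l ^ j *\<^sub>C lbr a (del b) j) = lbr_at a l (del b)"
        by (rule lbr_at_bound[symmetric]) (simp add: N)
      also have "\<dots> = del (\<Sum>j<Suc N. l ^ j *\<^sub>C lbr a b j) + l *\<^sub>C (\<Sum>j<N. l ^ j *\<^sub>C lbr a b j)"
        using lbr_at_bound[of N a b l] lbr_at_bound[of "Suc N" a b l] by (simp add: lbr_del_right N)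
      also have "\<dots> = (\<Sum>j<Suc N. l ^ j *\<^sub>C (del (lbr a b j) + (if j = 0 then 0 else lbr a b (j - 1))))"
        by (simp only: sum_pow_shift del_sum del_scale cvec.scale_right_distrib sum.distrib)
      finally show "(\<Sum>j<Suc N. l ^ j *\<^sub>C lbr a (del b) j) = \<dots>" .
    qed
  next
    case False
    then show ?thesis by (simp add: N)
  qed
qed

lemma shift_del_power:
  "((\<lambda>x::'a. - (l *\<^sub>C x) - del x) ^^ k) v =
     (\<Sum>j\<le>k. l ^ j *\<^sub>C ((- 1) ^ k * of_nat (k choose j)) *\<^sub>C (del ^^ (k - j)) v)"
proof (induction k)
  case (Suc k)
  let ?f = "\<lambda>k j. l ^ j *\<^sub>C ((- 1) ^ k * of_nat (k choose j)) *\<^sub>C (del ^^ (k - j)) v"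
  have 1: "(\<Sum>j\<le>k. - (l *\<^sub>C ?f k j)) = (\<Sum>j\<le>Suc k. if j = 0 then 0 else
      l ^ j *\<^sub>C ((- 1) ^ Suc k * of_nat (k choose (j - 1))) *\<^sub>C (del ^^ (Suc k - j)) v)"
    by (simp add: sum.atMost_Suc_shift scaleC_scaleC mult_ac del: sum.atMost_Suc flip: cvec.scale_minus_left)
  have 2: "(\<Sum>j\<le>k. - del (?f k j)) = (\<Sum>j\<le>Suc k.
      l ^ j *\<^sub>C ((- 1) ^ Suc k * of_nat (k choose j)) *\<^sub>C (del ^^ (Suc k - j)) v)"
    by (simp add: del_scale Suc_diff_le cvec.scale_minus_left)
  have "((\<lambda>x::'a. - (l *\<^sub>C x) - del x) ^^ Suc k) v = (\<Sum>j\<le>k. - (l *\<^sub>C ?f k j)) + (\<Sum>j\<le>k. - del (?f k j))"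
    by (simp add: Suc cvec.scale_sum_right del_sum sum_negf)
  also have "\<dots> = (\<Sum>j\<le>Suc k. ?f (Suc k) j)"
    unfolding 1 2 sum.distrib[symmetric]
  proof (rule sum.cong)
    fix j assume "j \<in> {..Suc k}"
    show "(if j = 0 then 0 else
      l ^ j *\<^sub>C ((- 1) ^ Suc k * of_nat (k choose (j - 1))) *\<^sub>C (del ^^ (Suc k - j)) v) +
      l ^ j *\<^sub>C ((- 1) ^ Suc k * of_nat (k choose j)) *\<^sub>C (del ^^ (Suc k - j)) v = ?f (Suc k) j"
      by (cases j) (simp_all add: scaleC_scaleC flip: scaleC_add_left, simp add: algebra_simps)
  qed simp
  finally show ?case .
qed (simp add: scaleC_one)

lemma lbr_skew_coeff:
  assumes "a \<in> homog i" "b \<in> homog j" and N: "\<And>k. k \<ge> N \<Longrightarrow> lbr b a k = 0" "\<And>k. k \<ge> N \<Longrightarrow> lbr a b k = 0"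
  shows "lbr a b n = - (koszul i j *\<^sub>C
    (\<Sum>k<N. ((- 1) ^ k * of_nat (k choose n)) *\<^sub>C (del ^^ (k - n)) (lbr b a k)))"
    (is "_ = ?r n")
proof (cases "n < N")
  case True
  show ?thesis
  proof (rule coeffs_eqI[OF _ True])
    fix l
    have "(\<Sum>n<N. l ^ n *\<^sub>C lbr a b n) = - (koszul i j *\<^sub>C lbr_at_skew b l a)"
      unfolding lbr_skew[OF assms(1,2), symmetric] by (rule lbr_at_bound[OF N(2), symmetric])
    also have "lbr_at_skew b l a = (\<Sum>k<N. \<Sum>n<N. l ^ n *\<^sub>C
        ((- 1) ^ k * of_nat (k choose n)) *\<^sub>C (del ^^ (k - n)) (lbr b a k))"
    proof -
      have "(\<Sum>n\<le>k. l ^ n *\<^sub>C ((- 1) ^ k * of_nat (k choose n)) *\<^sub>C (del ^^ (k - n)) (lbr b a k)) =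
          (\<Sum>n<N. l ^ n *\<^sub>C ((- 1) ^ k * of_nat (k choose n)) *\<^sub>C (del ^^ (k - n)) (lbr b a k))"
        if "k < N" for k
        by (rule sum.mono_neutral_left) (use that in auto)
      then show ?thesis
        by (simp add: lbr_at_skew_bound[OF N(1) del_zero] shift_del_power)
    qed
    also have "\<dots> = (\<Sum>n<N. l ^ n *\<^sub>C
        (\<Sum>k<N. ((- 1) ^ k * of_nat (k choose n)) *\<^sub>C (del ^^ (k - n)) (lbr b a k)))"
      by (subst sum.swap) (simp add: cvec.scale_sum_right)
    finally show "(\<Sum>n<N. l ^ n *\<^sub>C lbr a b n) = (\<Sum>n<N. l ^ n *\<^sub>C ?r n)"
      by (simp add: sum_negf cvec.scale_sum_right scaleC_scaleC mult_ac cvec.scale_minus_right)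
  qed
next
  case False
  then have "k choose n = 0" if "k < N" for k
    using that by simp
  then have "(\<Sum>k<N. ((- 1) ^ k * of_nat (k choose n)) *\<^sub>C (del ^^ (k - n)) (lbr b a k)) = 0"
    by (intro sum.neutral) auto
  then show ?thesis using False N by simp
qed

lemma lbr_jacobi_coeff:
  assumes "a \<in> homog i" "b \<in> homog j"
  shows "lbr a (lbr b c n) m - koszul i j *\<^sub>C lbr b (lbr a c m) n =
    (\<Sum>p\<le>m. of_nat ((m + n - p) choose n) *\<^sub>C lbr (lbr a b p) c (m + n - p))"
proof -
  define M where "M = (\<lambda>N. \<forall>k\<ge>N. lbr b c k = 0 \<and> lbr a c k = 0 \<and> lbr a b k = 0)"
  have "\<forall>\<^sub>F k in sequentially. lbr b c k = 0 \<and> lbr a c k = 0 \<and> lbr a b k = 0"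
    by (intro eventually_conj lbr_eventually_0)
  then obtain N0 where N0: "M N0"
    unfolding M_def eventually_sequentially by blast
  have "\<forall>\<^sub>F k in sequentially. \<forall>p\<in>{..<N0}.
      lbr a (lbr b c p) k = 0 \<and> lbr b (lbr a c p) k = 0 \<and> lbr (lbr a b p) c k = 0"
    by (intro eventually_ball_finite ballI eventually_conj lbr_eventually_0) simp
  then obtain N1 where N1: "\<And>p k. p < N0 \<Longrightarrow> k \<ge> N1 \<Longrightarrow>
      lbr a (lbr b c p) k = 0 \<and> lbr b (lbr a c p) k = 0 \<and> lbr (lbr a b p) c k = 0"
    unfolding eventually_sequentially by blast
  define N where "N = N0 + N1 + m + n + 1"
  have z: "lbr a (lbr b c p) k = 0" "lbr b (lbr a c p) k = 0" "lbr (lbr a b p) c k = 0"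
    if "k \<ge> N \<or> p \<ge> N" for p k
  proof -
    have "lbr a (lbr b c p) k = 0 \<and> lbr b (lbr a c p) k = 0 \<and> lbr (lbr a b p) c k = 0"
    proof (cases "p < N0")
      case True
      then have "k \<ge> N1" using that by (simp add: N_def)
      then show ?thesis using N1 True by blast
    next
      case False
      then have "lbr b c p = 0 \<and> lbr a c p = 0 \<and> lbr a b p = 0"
        using N0 by (simp add: M_def)
      then show ?thesis by simp
    qed
    then show "lbr a (lbr b c p) k = 0" "lbr b (lbr a c p) k = 0" "lbr (lbr a b p) c k = 0" by auto
  qed
  have zc: "k < N \<and> p < N" if "lbr (lbr a b p) c k \<noteq> 0" for p k
    using that z(3)[of k p] by (cases "N \<le> k"; cases "N \<le> p"; simp)
  have z1: "lbr b c k = 0" "lbr a c k = 0" "lbr a b k = 0" if "k \<ge> N" for k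
    using that N0 by (auto simp: M_def N_def)
  let ?L = "\<lambda>n m. lbr a (lbr b c n) m - koszul i j *\<^sub>C lbr b (lbr a c m) n"
  let ?R = "\<lambda>n m. \<Sum>p\<le>m. of_nat ((m + n - p) choose n) *\<^sub>C lbr (lbr a b p) c (m + n - p)"
  have *: "(\<Sum>n<2*N. y ^ n *\<^sub>C (\<Sum>m<2*N. x ^ m *\<^sub>C ?L n m)) = (\<Sum>n<2*N. y ^ n *\<^sub>C (\<Sum>m<2*N. x ^ m *\<^sub>C ?R n m))" for x y
  proof -
    have A: "lbr_at a x (lbr_at b y c) = (\<Sum>n<2*N. y ^ n *\<^sub>C (\<Sum>m<2*N. x ^ m *\<^sub>C lbr a (lbr b c n) m))"
    proof -
      have "lbr_at b y c = (\<Sum>n<2*N. y ^ n *\<^sub>C lbr b c n)"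
        by (rule lbr_at_bound) (use z1 in auto)
      moreover have "lbr_at a x (\<Sum>n<2*N. y ^ n *\<^sub>C lbr b c n) =
         (\<Sum>m<2*N. x ^ m *\<^sub>C lbr a (\<Sum>n<2*N. y ^ n *\<^sub>C lbr b c n) m)"
        by (rule lbr_at_bound) (use z in \<open>auto simp: lbr_sum_right lbr_scale_right\<close>)
      ultimately show ?thesis
        by (simp add: lbr_sum_right lbr_scale_right cvec.scale_sum_right scaleC_scaleC mult.commute)
          (rule sum.swap)
    qed
    have B: "lbr_at b y (lbr_at a x c) = (\<Sum>n<2*N. y ^ n *\<^sub>C (\<Sum>m<2*N. x ^ m *\<^sub>C lbr b (lbr a c m) n))"
    proof -
      have "lbr_at a x c = (\<Sum>m<2*N. x ^ m *\<^sub>C lbr a c m)"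
        by (rule lbr_at_bound) (use z1 in auto)
      moreover have "lbr_at b y (\<Sum>m<2*N. x ^ m *\<^sub>C lbr a c m) =
         (\<Sum>n<2*N. y ^ n *\<^sub>C lbr b (\<Sum>m<2*N. x ^ m *\<^sub>C lbr a c m) n)"
        by (rule lbr_at_bound) (use z in \<open>auto simp: lbr_sum_right lbr_scale_right\<close>)
      ultimately show ?thesis
        by (simp add: lbr_sum_right lbr_scale_right)
    qed
    have C: "lbr_at (lbr_at a x b) (x + y) c =
       (\<Sum>p<N. \<Sum>q<N. (x ^ p * (x + y) ^ q) *\<^sub>C lbr (lbr a b p) c q)"
    proof -
      have "lbr_at a x b = (\<Sum>p<N. x ^ p *\<^sub>C lbr a b p)"
        by (rule lbr_at_bound) (use z1 in auto)
      moreover have "lbr_at (\<Sum>p<N. x ^ p *\<^sub>C lbr a b p) (x + y) c =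
         (\<Sum>q<N. (x + y) ^ q *\<^sub>C lbr (\<Sum>p<N. x ^ p *\<^sub>C lbr a b p) c q)"
        by (rule lbr_at_bound) (use z in \<open>auto simp: lbr_sum_left lbr_scale_left\<close>)
      ultimately show ?thesis
        by (simp add: lbr_sum_left lbr_scale_left cvec.scale_sum_right scaleC_scaleC mult.commute)
          (rule sum.swap)
    qed
    let ?F = "\<lambda>p q n. (x ^ p * x ^ (q - n) * y ^ n * of_nat (q choose n)) *\<^sub>C lbr (lbr a b p) c q"
    let ?G = "\<lambda>n m p. (y ^ n * x ^ m * of_nat ((m + n - p) choose n)) *\<^sub>C lbr (lbr a b p) c (m + n - p)"
    let ?S' = "{(n, m, p). (n, m, p) \<in> (SIGMA n:{..<2*N}. SIGMA m:{..<2*N}. {..m}) \<and>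
        p < N \<and> m + n - p < N}"
    have "(x ^ p * (x + y) ^ q) *\<^sub>C lbr (lbr a b p) c q = (\<Sum>n\<le>q. ?F p q n)" for p q
    proof -
      have "(x ^ p * (x + y) ^ q) = (\<Sum>n\<le>q. x ^ p * x ^ (q - n) * y ^ n * of_nat (q choose n))"
        by (subst add.commute[of x]) (simp only: binomial_ring sum_distrib_left power_add mult_ac)
      then show ?thesis by (simp add: cvec.scale_sum_left)
    qed
    then have "lbr_at (lbr_at a x b) (x + y) c = (\<Sum>p<N. \<Sum>q<N. \<Sum>n\<le>q. ?F p q n)"
      unfolding C by simp
    also have "\<dots> = (\<Sum>(p, q, n)\<in>(SIGMA p:{..<N}. SIGMA q:{..<N}. {..q}). ?F p q n)"
      by (simp add: sum.Sigma)
    also have "\<dots> = (\<Sum>(n, m, p)\<in>?S'. ?G n m p)"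
      by (rule sum.reindex_bij_witness[where i = "\<lambda>(n, m, p). (p, m + n - p, n)"
            and j = "\<lambda>(p, q, n). (n, p + q - n, p)"]) (auto simp: mult_ac simp flip: power_add)
    also have "\<dots> = (\<Sum>(n, m, p)\<in>(SIGMA n:{..<2*N}. SIGMA m:{..<2*N}. {..m}). ?G n m p)"
      by (rule sum.mono_neutral_left) (auto dest: zc)
    also have "\<dots> = (\<Sum>n<2*N. \<Sum>m<2*N. \<Sum>p\<le>m.
       (y ^ n * x ^ m * of_nat ((m + n - p) choose n)) *\<^sub>C lbr (lbr a b p) c (m + n - p))"
      by (simp add: sum.Sigma)
    also have "\<dots> = (\<Sum>n<2*N. y ^ n *\<^sub>C (\<Sum>m<2*N. x ^ m *\<^sub>C ?R n m))"
      by (simp add: cvec.scale_sum_right scaleC_scaleC mult_ac)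
    finally have C': "lbr_at (lbr_at a x b) (x + y) c = \<dots>" .
    have "(\<Sum>n<2*N. y ^ n *\<^sub>C (\<Sum>m<2*N. x ^ m *\<^sub>C ?L n m)) =
      lbr_at a x (lbr_at b y c) - koszul i j *\<^sub>C lbr_at b y (lbr_at a x c)"
      unfolding A B by (simp add: cvec.scale_sum_right cvec.scale_right_diff_distrib sum_subtractf scaleC_scaleC mult_ac)
    also have "\<dots> = lbr_at (lbr_at a x b) (x + y) c"
      by (simp add: lbr_jacobi[OF assms])
    finally show ?thesis unfolding C' .
  qed
  have mn: "n < 2*N" "m < 2*N" by (auto simp: N_def)
  have "(\<Sum>m<2*N. x ^ m *\<^sub>C ?L n m) = (\<Sum>m<2*N. x ^ m *\<^sub>C ?R n m)" for x
    by (rule coeffs_eqI[OF * mn(1)])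
  from coeffs_eqI[OF this mn(2)] show ?thesis .
qed

end

abbreviation symbol :: "'a \<Rightarrow> int \<Rightarrow> ('a \<times> int) \<Rightarrow>\<^sub>0 complex"
  where "symbol a n \<equiv> Poly_Mapping.single (a, n) 1"

definition annih_relators :: "(('a::lie_conformal_superalgebra \<times> int) \<Rightarrow>\<^sub>0 complex) set"
  where "annih_relators =
      {symbol (del a) n + of_int n *\<^sub>C symbol a (n - 1) | a n. True}
    \<union> {symbol (a + b) n - symbol a n - symbol b n | a b n. True}
    \<union> {symbol (k *\<^sub>C a) n - k *\<^sub>C symbol a n | k a n. True}"

lemma equivp_diff_in_cspan: "equivp (\<lambda>x y. x - y \<in> cspan R)"
proof (intro equivpI reflpI sympI transpI)
  show "x - x \<in> cspan R" for x
    by (simp add: cvec.span_zero)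
  show "y - x \<in> cspan R" if "x - y \<in> cspan R" for x y
    using cvec.span_neg[OF that] by simp
  show "x - z \<in> cspan R" if "x - y \<in> cspan R" "y - z \<in> cspan R" for x y z
    using cvec.span_add[OF that] by simp
qed

quotient_type (overloaded) 'a annih =
  "('a::lie_conformal_superalgebra \<times> int) \<Rightarrow>\<^sub>0 complex" / "\<lambda>x y. x - y \<in> cspan annih_relators"
  by (rule equivp_diff_in_cspan)

instantiation annih :: (lie_conformal_superalgebra) complex_vector
begin

lift_definition zero_annih :: "'a annih" is 0 .

lift_definition plus_annih :: "'a annih \<Rightarrow> 'a annih \<Rightarrow> 'a annih" is "(+)"
  by (drule (1) cvec.span_add) (simp add: algebra_simps)

lift_definition minus_annih :: "'a annih \<Rightarrow> 'a annih \<Rightarrow> 'a annih" is "(-)"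
  by (drule (1) cvec.span_diff) (simp add: algebra_simps)

lift_definition uminus_annih :: "'a annih \<Rightarrow> 'a annih" is uminus
  by (metis (no_types, lifting) cvec.span_neg minus_diff_minus)

lift_definition scaleC_annih :: "complex \<Rightarrow> 'a annih \<Rightarrow> 'a annih" is scaleC
  by (metis (no_types, lifting) cvec.span_scale cvec.scale_right_diff_distrib)

instance
proof
  fix x y z :: "'a annih" and c d :: complex
  show "x + y + z = x + (y + z)" "x + y = y + x" "0 + x = x" "- x + x = 0" "x - y = x + - y"
    "c *\<^sub>C (x + y) = c *\<^sub>C x + c *\<^sub>C y" "(c + d) *\<^sub>C x = c *\<^sub>C x + d *\<^sub>C x"
    "c *\<^sub>C d *\<^sub>C x = (c * d) *\<^sub>C x" "1 *\<^sub>C x = x"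
    by (transfer; simp add: cvec.span_zero add.assoc add.commute scaleC_add_right scaleC_add_left
      scaleC_scaleC scaleC_one)+
qed

end

lift_definition mode :: "'a::lie_conformal_superalgebra \<Rightarrow> int \<Rightarrow> 'a annih"  \<comment> \<open>the class of \<open>a\<^sub>(\<^sub>n\<^sub>)\<close>\<close>
  is symbol .

text \<open>The bracket \<open>[a\<^sub>(\<^sub>m\<^sub>), b\<^sub>(\<^sub>n\<^sub>)]\<close> of symbols and its bilinear extension to formal combinations.\<close>

definition symbol_lie :: "'a::lie_conformal_superalgebra \<times> int \<Rightarrow> 'a \<times> int \<Rightarrow> 'a annih"
  where "symbol_lie s t = (case (s, t) of ((a, m), (b, n)) \<Rightarrow>
    \<Sum>j | nprod a j b \<noteq> 0. (of_int m gchoose j) *\<^sub>C mode (nprod a j b) (m + n - int j))"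

definition free_lie ::
  "(('a::lie_conformal_superalgebra \<times> int) \<Rightarrow>\<^sub>0 complex) \<Rightarrow> (('a \<times> int) \<Rightarrow>\<^sub>0 complex) \<Rightarrow> 'a annih"
  where "free_lie x y = (\<Sum>s\<in>Poly_Mapping.keys x. \<Sum>t\<in>Poly_Mapping.keys y.
    (Poly_Mapping.lookup x s * Poly_Mapping.lookup y t) *\<^sub>C symbol_lie s t)"

subsection \<open>The bracket is well defined\<close>

lemma mode_add: "mode (a + b) n = mode a n + mode b n"
proof (transfer)
  fix a b :: 'a and n :: int
  have "symbol (a + b) n - symbol a n - symbol b n \<in> annih_relators"
    unfolding annih_relators_def by blast
  from cvec.span_base[OF this] show "symbol (a + b) n - (symbol a n + symbol b n) \<in> cspan annih_relators"
    by (simp add: diff_diff_eq)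
qed

lemma mode_scale: "mode (k *\<^sub>C a) n = k *\<^sub>C mode a n"
proof (transfer)
  fix a :: 'a and n :: int and k
  have "symbol (k *\<^sub>C a) n - k *\<^sub>C symbol a n \<in> annih_relators"
    unfolding annih_relators_def by blast
  from cvec.span_base[OF this] show "symbol (k *\<^sub>C a) n - k *\<^sub>C symbol a n \<in> cspan annih_relators" .
qed

lemma mode_del: "mode (del a) n = - of_int n *\<^sub>C mode a (n - 1)"
proof (transfer)
  fix a :: 'a and n :: int and k
  have "symbol (del a) n + of_int n *\<^sub>C symbol a (n - 1) \<in> annih_relators"
    unfolding annih_relators_def by blast
  from cvec.span_base[OF this]
  show "symbol (del a) n - (- of_int n *\<^sub>C symbol a (n - 1)) \<in> cspan annih_relators"
    by (simp add: cvec.scale_minus_left)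
qed

lemma clinear_mode: "clinear (\<lambda>a. mode a n)"
  by unfold_locales (simp_all add: mode_add mode_scale)

lemmas mode_zero [simp] = module_hom.zero[OF clinear_mode]
  and mode_neg = module_hom.neg[OF clinear_mode]
  and mode_diff = module_hom.diff[OF clinear_mode]
  and mode_sum = module_hom.sum[OF clinear_mode]

definition free_ext :: "('b \<Rightarrow> 'c) \<Rightarrow> ('b \<Rightarrow>\<^sub>0 complex) \<Rightarrow> 'c::complex_vector"
  where "free_ext f x = (\<Sum>s\<in>Poly_Mapping.keys x. Poly_Mapping.lookup x s *\<^sub>C f s)"

lemma free_ext_superset:
  assumes "finite A" "Poly_Mapping.keys x \<subseteq> A"
  shows "free_ext f x = (\<Sum>s\<in>A. Poly_Mapping.lookup x s *\<^sub>C f s)"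
  unfolding free_ext_def
  by (rule sum.mono_neutral_left) (use assms in \<open>auto simp: in_keys_iff\<close>)

lemma clinear_free_ext:
  fixes f :: "'b \<Rightarrow> 'c::complex_vector"
  shows "clinear (free_ext f)"
proof unfold_locales
  fix x y :: "'b \<Rightarrow>\<^sub>0 complex" and c :: complex
  let ?A = "Poly_Mapping.keys x \<union> Poly_Mapping.keys y"
  show "free_ext f (x + y) = free_ext f x + free_ext f y"
    using Poly_Mapping.keys_add[of x y]
    by (subst (1 2 3) free_ext_superset[of ?A])
      (auto simp: lookup_add scaleC_add_left sum.distrib)
  have "Poly_Mapping.keys (c *\<^sub>C x) \<subseteq> Poly_Mapping.keys x"
    by (auto simp: in_keys_iff lookup_scaleC)
  then show "free_ext f (c *\<^sub>C x) = c *\<^sub>C free_ext f x"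
    by (subst (1 2) free_ext_superset[of "Poly_Mapping.keys x"])
      (auto simp: lookup_scaleC scaleC_complex_def cvec.scale_sum_right scaleC_scaleC)
qed

lemmas free_ext_hom =
  module_hom.add[OF clinear_free_ext] module_hom.diff[OF clinear_free_ext]
  module_hom.scale[OF clinear_free_ext] module_hom.zero[OF clinear_free_ext]
  module_hom.neg[OF clinear_free_ext]

lemma free_ext_single: "free_ext f (Poly_Mapping.single s c) = c *\<^sub>C f s"
  by (simp add: free_ext_def)

lemma clinear_compose_sum_scale:
  "free_ext (\<lambda>s. free_ext (f s) y) x = (\<Sum>s\<in>Poly_Mapping.keys x. \<Sum>t\<in>Poly_Mapping.keys y.
    (Poly_Mapping.lookup x s * Poly_Mapping.lookup y t) *\<^sub>C f s t)"
  by (simp add: free_ext_def cvec.scale_sum_right scaleC_scaleC)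

lemma free_ext_swap:
  "free_ext (\<lambda>s. free_ext (f s) y) x = free_ext (\<lambda>t. free_ext (\<lambda>s. f s t) x) y"
  unfolding clinear_compose_sum_scale by (subst sum.swap) (simp add: mult.commute)

lemma free_lie_ext: "free_lie x y = free_ext (\<lambda>s. free_ext (symbol_lie s) y) x"
  by (simp add: free_lie_def clinear_compose_sum_scale)

lemma free_lie_ext': "free_lie x y = free_ext (\<lambda>t. free_ext (\<lambda>s. symbol_lie s t) x) y"
  unfolding free_lie_ext by (rule free_ext_swap)

lemma nprod_zero_iff: "nprod a j b = 0 \<longleftrightarrow> lbr a b j = 0"
  by (simp add: nprod_def)

lemma symbol_lie_bound:
  assumes "\<And>j. j \<ge> N \<Longrightarrow> lbr a b j = 0"
  shows "symbol_lie (a, m) (b, n) = (\<Sum>j<N. (of_int m gchoose j) *\<^sub>C mode (nprod a j b) (m + n - int j))"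
  unfolding symbol_lie_def prod.case
  by (rule sum.mono_neutral_left)
    (use assms in \<open>auto simp: nprod_def simp flip: not_le\<close>)

lemma symbol_lie_eventually:
  "\<forall>\<^sub>F N in sequentially. symbol_lie (a, m) (b, n) =
     (\<Sum>j<N. (of_int m gchoose j) *\<^sub>C mode (nprod a j b) (m + n - int j))"
proof -
  obtain N where "\<And>j. j \<ge> N \<Longrightarrow> lbr a b j = 0" using lbr_bound[of a b] by blast
  then show ?thesis
    by (auto simp: eventually_sequentially intro!: exI[of _ N] symbol_lie_bound)
qed

lemma nprod_hom:
  "nprod (a + b) j c = nprod a j c + nprod b j c" "nprod c j (a + b) = nprod c j a + nprod c j b"
  "nprod (k *\<^sub>C a) j c = k *\<^sub>C nprod a j c" "nprod c j (k *\<^sub>C a) = k *\<^sub>C nprod c j a"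
  by (simp_all add: nprod_def lbr_add_left lbr_add_right lbr_scale_left lbr_scale_right
      scaleC_add_right scaleC_scaleC mult.commute)

lemma symbol_lie_add_left: "symbol_lie (a + b, m) (c, n) = symbol_lie (a, m) (c, n) + symbol_lie (b, m) (c, n)"
proof -
  have "\<forall>\<^sub>F N in sequentially. symbol_lie (a + b, m) (c, n) = symbol_lie (a, m) (c, n) + symbol_lie (b, m) (c, n)"
    using symbol_lie_eventually[of "a + b" m c n] symbol_lie_eventually[of a m c n] symbol_lie_eventually[of b m c n]
    by eventually_elim (simp add: nprod_hom mode_add scaleC_add_right sum.distrib)
  then show ?thesis by simp
qed

lemma symbol_lie_add_right: "symbol_lie (c, m) (a + b, n) = symbol_lie (c, m) (a, n) + symbol_lie (c, m) (b, n)"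
proof -
  have "\<forall>\<^sub>F N in sequentially. symbol_lie (c, m) (a + b, n) = symbol_lie (c, m) (a, n) + symbol_lie (c, m) (b, n)"
    using symbol_lie_eventually[of c m "a + b" n] symbol_lie_eventually[of c m a n] symbol_lie_eventually[of c m b n]
    by eventually_elim (simp add: nprod_hom mode_add scaleC_add_right sum.distrib)
  then show ?thesis by simp
qed

lemma symbol_lie_scale_left: "symbol_lie (k *\<^sub>C a, m) (c, n) = k *\<^sub>C symbol_lie (a, m) (c, n)"
proof -
  have "\<forall>\<^sub>F N in sequentially. symbol_lie (k *\<^sub>C a, m) (c, n) = k *\<^sub>C symbol_lie (a, m) (c, n)"
    using symbol_lie_eventually[of "k *\<^sub>C a" m c n] symbol_lie_eventually[of a m c n]
    by eventually_elim (simp add: nprod_hom mode_scale cvec.scale_sum_right scaleC_scaleC mult.commute)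
  then show ?thesis by simp
qed

lemma symbol_lie_scale_right: "symbol_lie (c, m) (k *\<^sub>C a, n) = k *\<^sub>C symbol_lie (c, m) (a, n)"
proof -
  have "\<forall>\<^sub>F N in sequentially. symbol_lie (c, m) (k *\<^sub>C a, n) = k *\<^sub>C symbol_lie (c, m) (a, n)"
    using symbol_lie_eventually[of c m "k *\<^sub>C a" n] symbol_lie_eventually[of c m a n]
    by eventually_elim (simp add: nprod_hom mode_scale cvec.scale_sum_right scaleC_scaleC mult.commute)
  then show ?thesis by simp
qed

lemma nprod_del_left: "nprod (del a) j b = - (if j = 0 then 0 else of_nat j *\<^sub>C nprod a (j - 1) b)"
  by (cases j) (simp_all add: nprod_def lbr_del_left_coeff scaleC_scaleC)

lemma nprod_del_right:
  "nprod a j (del b) = del (nprod a j b) + (if j = 0 then 0 else of_nat j *\<^sub>C nprod a (j - 1) b)"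
  by (cases j) (simp_all add: nprod_def lbr_del_right_coeff scaleC_scaleC scaleC_add_right del_scale)

lemma gbinomial_Suc_absorb: "(x gchoose Suc j) * of_nat (Suc j) = (x::complex) * ((x - 1) gchoose j)"
  using gbinomial_absorption'[of "Suc j" x] by (simp del: of_nat_Suc)

lemma symbol_lie_del_left: "symbol_lie (del a, m) (b, n) = - of_int m *\<^sub>C symbol_lie (a, m - 1) (b, n)"
proof -
  have "\<forall>\<^sub>F N in sequentially. symbol_lie (del a, m) (b, n) = (\<Sum>j<Suc N. (of_int m gchoose j) *\<^sub>C mode (nprod (del a) j b) (m + n - int j))"
    using symbol_lie_eventually[of "del a" m b n] by (subst eventually_sequentially_Suc)
  then have "\<forall>\<^sub>F N in sequentially. symbol_lie (del a, m) (b, n) = - of_int m *\<^sub>C symbol_lie (a, m - 1) (b, n)"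
    using symbol_lie_eventually[of a "m - 1" b n]
  proof eventually_elim
    case (elim N)
    have "(of_int m gchoose Suc j) * of_nat (Suc j) = of_int m * (of_int (m - 1) gchoose j :: complex)" for j
      unfolding of_int_diff of_int_1 by (rule gbinomial_Suc_absorb)
    moreover have idx: "m + n - int (Suc j) = m - 1 + n - int j" for j by simp
    ultimately show ?case
      unfolding elim
      by (simp add: sum.lessThan_Suc_shift nprod_del_left mode_neg mode_scale scaleC_scaleC cvec.scale_sum_right
        cvec.scale_minus_left cvec.scale_minus_right sum_negf idx del: sum.lessThan_Suc of_nat_Suc)
  qed
  then show ?thesis by simp
qed

lemma symbol_lie_del_right: "symbol_lie (a, m) (del b, n) = - of_int n *\<^sub>C symbol_lie (a, m) (b, n - 1)"
proof -
  have "\<forall>\<^sub>F N in sequentially. symbol_lie (a, m) (del b, n) = (\<Sum>j<Suc N. (of_int m gchoose j) *\<^sub>C mode (nprod a j (del b)) (m + n - int j))"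
    using symbol_lie_eventually[of a m "del b" n] by (subst eventually_sequentially_Suc)
  moreover have "\<forall>\<^sub>F N in sequentially. nprod a N b = 0"
    using lbr_eventually_0[of a b] by (simp add: nprod_zero_iff)
  ultimately have "\<forall>\<^sub>F N in sequentially. symbol_lie (a, m) (del b, n) = - of_int n *\<^sub>C symbol_lie (a, m) (b, n - 1)"
    using symbol_lie_eventually[of a m b "n - 1"]
  proof eventually_elim
    case (elim N)
    have idx: "m + n - int (Suc j) = m + n - 1 - int j" for j by simp
    let ?v = "\<lambda>j. mode (nprod a j b) (m + n - 1 - int j)"
    have "symbol_lie (a, m) (del b, n) =
       (\<Sum>j<Suc N. (of_int m gchoose j) *\<^sub>C mode (del (nprod a j b)) (m + n - int j)) +
       (\<Sum>j<Suc N. (of_int m gchoose j) *\<^sub>C mode (if j = 0 then 0 else of_nat j *\<^sub>C nprod a (j - 1) b) (m + n - int j))"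
      unfolding elim(1) nprod_del_right by (simp only: mode_add scaleC_add_right sum.distrib)
    also have "(\<Sum>j<Suc N. (of_int m gchoose j) *\<^sub>C mode (del (nprod a j b)) (m + n - int j)) =
       (\<Sum>j<N. ((of_int m gchoose j) * - of_int (m + n - int j)) *\<^sub>C ?v j)"
      by (simp add: elim(2) mode_del scaleC_scaleC algebra_simps)
    also have "(\<Sum>j<Suc N. (of_int m gchoose j) *\<^sub>C mode (if j = 0 then 0 else of_nat j *\<^sub>C nprod a (j - 1) b) (m + n - int j)) =
       (\<Sum>j<N. ((of_int m gchoose Suc j) * of_nat (Suc j)) *\<^sub>C ?v j)"
      by (simp add: sum.lessThan_Suc_shift mode_scale scaleC_scaleC idx del: sum.lessThan_Suc of_nat_Suc)
    also have "(\<Sum>j<N. ((of_int m gchoose j) * - of_int (m + n - int j)) *\<^sub>C ?v j) +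
       (\<Sum>j<N. ((of_int m gchoose Suc j) * of_nat (Suc j)) *\<^sub>C ?v j) =
       (\<Sum>j<N. (- of_int n * (of_int m gchoose j)) *\<^sub>C ?v j)"
      unfolding sum.distrib[symmetric]
    proof (rule sum.cong)
      fix j
      have "(of_int m gchoose j) * - of_int (m + n - int j) + (of_int m gchoose Suc j) * of_nat (Suc j)
         = - of_int n * ((of_int m :: complex) gchoose j)"
        using gbinomial_absorb_comp[of "of_int m :: complex" j] gbinomial_Suc_absorb[of "of_int m" j]
        by (simp add: algebra_simps)
      then show "((of_int m gchoose j) * - of_int (m + n - int j)) *\<^sub>C ?v j +
           ((of_int m gchoose Suc j) * of_nat (Suc j)) *\<^sub>C ?v j = (- of_int n * (of_int m gchoose j)) *\<^sub>C ?v j"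
        by (simp flip: scaleC_add_left)
    qed simp
    also have "\<dots> = - of_int n *\<^sub>C symbol_lie (a, m) (b, n - 1)"
      unfolding elim(3) by (simp add: cvec.scale_sum_right scaleC_scaleC add_diff_eq)
    finally show ?case .
  qed
  then show ?thesis by simp
qed

lemma free_lie_relators:
  assumes "r \<in> cspan annih_relators"
  shows "free_lie r x = 0" "free_lie x r = 0"
proof -
  have "free_ext (\<lambda>s. symbol_lie s t) r = 0" for t
  proof (rule module_hom.eq_0_on_span[OF clinear_free_ext _ assms[unfolded cspan_def]])
    fix q :: "('a \<times> int) \<Rightarrow>\<^sub>0 complex" assume "q \<in> annih_relators"
    then show "free_ext (\<lambda>s. symbol_lie s t) q = 0"
      unfolding annih_relators_def
      by (cases t) (auto simp: free_ext_hom free_ext_single scaleC_one symbol_lie_del_left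
          symbol_lie_add_left symbol_lie_scale_left cvec.scale_minus_left)
  qed
  then show "free_lie r x = 0" by (simp add: free_lie_ext' free_ext_def)
  have "free_ext (symbol_lie s) r = 0" for s
  proof (rule module_hom.eq_0_on_span[OF clinear_free_ext _ assms[unfolded cspan_def]])
    fix q :: "('a \<times> int) \<Rightarrow>\<^sub>0 complex" assume "q \<in> annih_relators"
    then show "free_ext (symbol_lie s) q = 0"
      unfolding annih_relators_def
      by (cases s) (auto simp: free_ext_hom free_ext_single scaleC_one symbol_lie_del_right
          symbol_lie_add_right symbol_lie_scale_right cvec.scale_minus_left)
  qed
  then show "free_lie x r = 0" by (simp add: free_lie_ext free_ext_def)
qed

lemma free_lie_hom:
  "free_lie (x + y) z = free_lie x z + free_lie y z"
  "free_lie (x - y) z = free_lie x z - free_lie y z"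
  "free_lie (c *\<^sub>C x) z = c *\<^sub>C free_lie x z"
  unfolding free_lie_ext by (rule free_ext_hom)+

lemma free_lie_hom':
  "free_lie z (x + y) = free_lie z x + free_lie z y"
  "free_lie z (x - y) = free_lie z x - free_lie z y"
  "free_lie z (c *\<^sub>C x) = c *\<^sub>C free_lie z x"
  unfolding free_lie_ext' by (rule free_ext_hom)+

lift_definition annih_lie :: "'a::lie_conformal_superalgebra annih \<Rightarrow> 'a annih \<Rightarrow> 'a annih" is free_lie
proof -
  fix x x' y y' :: "('a \<times> int) \<Rightarrow>\<^sub>0 complex"
  assume *: "x - x' \<in> cspan annih_relators" "y - y' \<in> cspan annih_relators"
  have "free_lie x y - free_lie x' y' = free_lie (x - x') y + free_lie x' (y - y')"
    by (simp add: free_lie_hom free_lie_hom')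
  then show "free_lie x y = free_lie x' y'"
    by (simp add: free_lie_relators[OF *(1)] free_lie_relators[OF *(2)])
qed

lemma annih_lie_mode:
  "annih_lie (mode a m) (mode b n) = symbol_lie (a, m) (b, n)"
  by transfer (simp add: free_lie_ext free_ext_single scaleC_one)

lemma annih_lie_hom:
  "annih_lie (x + y) z = annih_lie x z + annih_lie y z" "annih_lie z (x + y) = annih_lie z x + annih_lie z y"
  "annih_lie (c *\<^sub>C x) z = c *\<^sub>C annih_lie x z" "annih_lie z (c *\<^sub>C x) = c *\<^sub>C annih_lie z x"
  by (transfer, simp add: free_lie_hom free_lie_hom')+

subsection \<open>Grading\<close>

lemma clinear_eq_on_span:
  assumes f: "clinear f" and g: "clinear g" and eq: "\<And>x. x \<in> B \<Longrightarrow> f x = g x" and x: "x \<in> cspan B"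
  shows "f x = g x"
  using x
proof (induction rule: cvec.span_induct_alt)
  case base
  show ?case by (simp add: module_hom.zero[OF f] module_hom.zero[OF g])
next
  case (step c x y)
  then show ?case
    by (simp add: eq module_hom.add[OF f] module_hom.add[OF g] module_hom.scale[OF f] module_hom.scale[OF g])
qed

lemma sum_Sigma3:
  assumes "finite A" "\<And>x. finite (B x)" "\<And>x y. finite (C x y)"
  shows "(\<Sum>x\<in>A. \<Sum>y\<in>B x. \<Sum>z\<in>C x y. f x y z) = (\<Sum>(x, y, z)\<in>(SIGMA x:A. SIGMA y:B x. C x y). f x y z)"
  using assms by (simp add: sum.Sigma)

lemma clinear_abs_annih: "clinear (abs_annih :: _ \<Rightarrow> 'a::lie_conformal_superalgebra annih)"
  by unfold_locales (simp_all add: plus_annih.abs_eq scaleC_annih.abs_eq)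

lemma abs_annih_eq: "abs_annih x = (\<Sum>(a, n)\<in>Poly_Mapping.keys x. Poly_Mapping.lookup x (a, n) *\<^sub>C mode a n)"
proof -
  have "x = (\<Sum>s\<in>Poly_Mapping.keys x. Poly_Mapping.lookup x s *\<^sub>C Poly_Mapping.single s 1)"
    by (rule poly_mapping_eqI)
      (auto simp: lookup_sum lookup_scaleC lookup_single when_def scaleC_complex_def in_keys_iff if_distrib
        sum.delta cong: if_cong)
  then have "abs_annih x = abs_annih (\<Sum>s\<in>Poly_Mapping.keys x. Poly_Mapping.lookup x s *\<^sub>C Poly_Mapping.single s 1)"
    by simp
  then show ?thesis
    by (simp add: module_hom.sum[OF clinear_abs_annih] module_hom.scale[OF clinear_abs_annih]
        mode.abs_eq case_prod_unfold)
qed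

lemma annih_span: "cspan {mode a n | a n. True} = UNIV"
proof -
  have "x \<in> cspan {mode a n | a n. True}" for x :: "'a annih"
  proof (induction x rule: annih.abs_induct)
    case (1 y)
    show ?case
      unfolding abs_annih_eq
      by (intro cvec.span_sum) (auto intro!: cvec.span_scale[OF cvec.span_base])
  qed
  then show ?thesis by blast
qed

context
  fixes dummy :: "'a::super_vector itself"
begin

lemma csubspace_homog: "csubspace (homog i :: 'a set)"
  by (simp add: cvec.subspace_def homog_zero homog_add homog_scale)

definition even_comp :: "'a \<Rightarrow> 'a" where "even_comp x = (SOME y. y \<in> homog 0 \<and> x - y \<in> homog 1)"

lemma even_comp: "even_comp x \<in> homog 0" "x - even_comp x \<in> homog 1"
proof -
  obtain y z :: 'a where "y \<in> homog 0" "z \<in> homog 1" "x = y + z" using homog_sum by blast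
  then have "y \<in> homog 0 \<and> x - y \<in> homog 1" by simp
  then have "even_comp x \<in> homog 0 \<and> x - even_comp x \<in> homog 1"
    unfolding even_comp_def by (rule someI)
  then show "even_comp x \<in> homog 0" "x - even_comp x \<in> homog 1" by auto
qed

lemma even_comp_unique:
  assumes "y \<in> homog 0" "x - y \<in> homog 1"
  shows "even_comp x = (y::'a)"
proof -
  have "even_comp x - y \<in> homog 0"
    using assms even_comp cvec.subspace_diff[OF csubspace_homog] by blast
  moreover have "(x - y) - (x - even_comp x) \<in> homog 1"
    using assms even_comp cvec.subspace_diff[OF csubspace_homog] by blast
  ultimately have "even_comp x - y \<in> homog 0 \<inter> homog 1" by simp
  then show ?thesis unfolding homog_Int by simp
qed

lemma clinear_even_comp: "clinear even_comp"
proof unfold_locales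
  fix x y :: 'a and c
  show "even_comp (x + y) = even_comp x + even_comp y"
  proof (rule even_comp_unique)
    have "x + y - (even_comp x + even_comp y) = (x - even_comp x) + (y - even_comp y)" by simp
    then show "x + y - (even_comp x + even_comp y) \<in> homog 1" by (simp only: homog_add even_comp)
  qed (simp add: homog_add even_comp)
  show "even_comp (c *\<^sub>C x) = c *\<^sub>C even_comp x"
    by (rule even_comp_unique)
      (simp_all add: homog_scale even_comp flip: cvec.scale_right_diff_distrib)
qed

end

lemma even_comp_del: "even_comp (del a) = del (even_comp (a::'a::lie_conformal_superalgebra))"
proof (rule even_comp_unique)
  show "del (even_comp a) \<in> homog 0" by (simp add: del_homog even_comp)
  have "del a - del (even_comp a) = del (a - even_comp a)"
    by (simp add: module_hom.diff[OF module_hom_del])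
  then show "del a - del (even_comp a) \<in> homog 1" by (simp add: del_homog even_comp)
qed

lift_definition annih_even_comp :: "'a::lie_conformal_superalgebra annih \<Rightarrow> 'a annih"
  is "free_ext (\<lambda>(a, n). mode (even_comp a) n)"
proof -
  fix x y :: "('a \<times> int) \<Rightarrow>\<^sub>0 complex" assume "x - y \<in> cspan annih_relators"
  then have "free_ext (\<lambda>(a, n). mode (even_comp a) n) (x - y) = 0"
    unfolding cspan_def
  proof (rule module_hom.eq_0_on_span[OF clinear_free_ext, rotated])
    fix q :: "('a \<times> int) \<Rightarrow>\<^sub>0 complex" assume "q \<in> annih_relators"
    then show "free_ext (\<lambda>(a, n). mode (even_comp a) n) q = 0"
      unfolding annih_relators_def
      by (auto simp: free_ext_hom free_ext_single scaleC_one even_comp_del mode_del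
          module_hom.add[OF clinear_even_comp] module_hom.scale[OF clinear_even_comp]
          mode_add mode_scale cvec.scale_minus_left)
  qed
  then show "free_ext (\<lambda>(a, n). mode (even_comp a) n) x = free_ext (\<lambda>(a, n). mode (even_comp a) n) y"
    by (simp add: free_ext_hom)
qed

lemma annih_even_comp_mode: "annih_even_comp (mode a n) = mode (even_comp a) n"
  by transfer (simp add: free_ext_single scaleC_one)

lemma clinear_annih_even_comp: "clinear annih_even_comp"
  by unfold_locales (transfer, simp add: free_ext_hom)+

instantiation annih :: (lie_conformal_superalgebra) super_vector
begin

definition homog_annih :: "bit \<Rightarrow> 'a annih set"
  where "homog_annih i = cspan {mode a n | a n. a \<in> homog i}"

instance
proof
  fix x y :: "'a annih" and i :: bit and c :: complex
  show "(0 :: 'a annih) \<in> homog i" "x \<in> homog i \<Longrightarrow> y \<in> homog i \<Longrightarrow> x + y \<in> homog i"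
    "x \<in> homog i \<Longrightarrow> c *\<^sub>C x \<in> homog i" for x y :: "'a annih"
    unfolding homog_annih_def
    by (simp_all add: cvec.span_zero cvec.span_add cvec.span_scale)
  show "homog 0 \<inter> homog 1 = {0 :: 'a annih}"
  proof -
    have "x = 0" if "x \<in> homog 0" "x \<in> homog 1" for x :: "'a annih"
    proof -
      have "annih_even_comp x = id x"
      proof (rule clinear_eq_on_span[OF clinear_annih_even_comp])
        show "clinear (id :: 'a annih \<Rightarrow> _)" by unfold_locales auto
        show "x \<in> cspan {mode a n | a n. a \<in> homog 0}"
          using that(1) by (simp add: homog_annih_def)
        have "even_comp a = a" if "a \<in> homog 0" for a :: 'a
          by (rule even_comp_unique) (use that homog_zero in auto)
        then show "annih_even_comp y = id y" if "y \<in> {mode a n | a n. a \<in> homog 0}" for y :: "'a annih"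
          using that by (auto simp: annih_even_comp_mode)
      qed
      moreover have "annih_even_comp x = 0"
      proof (rule module_hom.eq_0_on_span[OF clinear_annih_even_comp])
        show "x \<in> module.span scaleC {mode a n | a n. a \<in> homog 1}"
          using that(2) by (simp add: homog_annih_def cspan_def)
        have "even_comp a = 0" if "a \<in> homog 1" for a :: 'a
          by (rule even_comp_unique) (use that homog_zero in auto)
        then show "annih_even_comp y = 0" if "y \<in> {mode a n | a n. a \<in> homog 1}" for y :: "'a annih"
          using that by (auto simp: annih_even_comp_mode)
      qed
      ultimately show ?thesis by simp
    qed
    moreover have "0 \<in> (homog i :: 'a annih set)" for i
      by (simp add: homog_annih_def cvec.span_zero)
    ultimately show ?thesis by blast
  qed
  show "\<exists>y\<in>homog 0. \<exists>z\<in>homog 1. x = y + z"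
  proof -
    let ?T = "{y + z | y z. y \<in> (homog 0 :: 'a annih set) \<and> z \<in> homog 1}"
    have "csubspace ?T"
      unfolding csubspace_def homog_annih_def cspan_def
      by (intro cvec.subspace_sums[unfolded csubspace_def] cvec.subspace_span[unfolded csubspace_def cspan_def])
    moreover have "mode a n \<in> ?T" for a :: 'a and n
    proof -
      have "mode a n = mode (even_comp a) n + mode (a - even_comp a) n"
        by (simp add: mode_diff)
      moreover have "mode (even_comp a) n \<in> homog 0" "mode (a - even_comp a) n \<in> homog 1"
        unfolding homog_annih_def by (intro cvec.span_base; use even_comp in blast)+
      ultimately show ?thesis by blast
    qed
    ultimately have "cspan {mode a n | a n. True} \<subseteq> ?T"
      by (intro cvec.span_minimal) auto
    then show ?thesis unfolding annih_span by blast
  qed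
qed

end

lemma mode_homog: "a \<in> homog i \<Longrightarrow> mode a n \<in> homog i"
  unfolding homog_annih_def by (rule cvec.span_base) blast

lemma annih_eq_on_homog:
  assumes "clinear f" "clinear g" "\<And>a n. a \<in> homog i \<Longrightarrow> f (mode a n) = g (mode a n)" "x \<in> homog i"
  shows "f x = g (x :: 'a::lie_conformal_superalgebra annih)"
  by (rule clinear_eq_on_span[OF assms(1,2), of "{mode a n | a n. a \<in> homog i}"])
    (use assms(3,4) in \<open>auto simp: homog_annih_def\<close>)

lemma annih_eq_on_UNIV:
  assumes "clinear f" "clinear g" "\<And>a n. f (mode a n) = g (mode a n)"
  shows "f x = g (x :: 'a::lie_conformal_superalgebra annih)"
  by (rule clinear_eq_on_span[OF assms(1,2), of "{mode a n | a n. True}"])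
    (use assms(3) annih_span in \<open>auto\<close>)

subsection \<open>Skew-symmetry and the Jacobi identity\<close>

lemma mode_del_power:
  "mode ((del ^^ i) v) p = ((- 1) ^ i * fact i * (of_int p gchoose i)) *\<^sub>C mode v (p - int i)"
proof (induction i arbitrary: p)
  case (Suc i)
  have "(del ^^ Suc i) v = del ((del ^^ i) v)" by simp
  then have "mode ((del ^^ Suc i) v) p =
      (- of_int p * ((- 1) ^ i * fact i * (of_int (p - 1) gchoose i))) *\<^sub>C mode v (p - 1 - int i)"
    by (simp only: mode_del Suc scaleC_scaleC)
  also have "- of_int p * ((- 1) ^ i * fact i * (of_int (p - 1) gchoose i)) =
      (- 1) ^ Suc i * fact i * (of_int p * ((of_int p - 1 :: complex) gchoose i))"
    by simp
  also have "\<dots> = (- 1) ^ Suc i * fact (Suc i) * (of_int p gchoose Suc i)"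
    unfolding gbinomial_Suc_absorb[symmetric] by (simp add: algebra_simps)
  finally show ?case by (simp add: algebra_simps)
qed (simp add: scaleC_one)

lemma skew_coeff:
  fixes m n :: complex
  shows "(\<Sum>j\<le>k. (- 1) ^ j * (m gchoose j) * (m + n - of_nat j gchoose (k - j))) = (n gchoose k)"
proof -
  have "(\<Sum>j\<le>k. (- 1) ^ j * (m gchoose j) * (m + n - of_nat j gchoose (k - j))) =
     (\<Sum>j\<le>k. (- 1) ^ k * ((m gchoose j) * (of_nat k - 1 - m - n gchoose (k - j))))"
  proof (rule sum.cong)
    fix j assume "j \<in> {..k}"
    then have "(m + n - of_nat j gchoose (k - j)) = (- 1) ^ (k - j) * (of_nat k - 1 - m - n gchoose (k - j))"
      by (subst gbinomial_negated_upper) (simp add: of_nat_diff algebra_simps)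
    note h1 = this
    have h2: "(- 1 :: complex) ^ j * (- 1) ^ (k - j) = (- 1) ^ k"
      using \<open>j \<in> {..k}\<close> by (simp flip: power_add)
    show "(- 1) ^ j * (m gchoose j) * (m + n - of_nat j gchoose (k - j)) =
        (- 1) ^ k * ((m gchoose j) * (of_nat k - 1 - m - n gchoose (k - j)))"
      unfolding h1 h2[symmetric] by (simp only: mult_ac)
  qed simp
  also have "\<dots> = (- 1) ^ k * (m + (of_nat k - 1 - m - n) gchoose k)"
    unfolding gbinomial_Vandermonde[symmetric] atLeast0AtMost sum_distrib_left ..
  also have "\<dots> = (n gchoose k)"
    by (subst (2) gbinomial_negated_upper) (simp add: algebra_simps)
  finally show ?thesis .
qed

lemma symbol_lie_skew:
  fixes a b :: "'a::lie_conformal_superalgebra"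
  assumes "a \<in> homog i" "b \<in> homog j"
  shows "symbol_lie (a, m) (b, n) = - (koszul i j *\<^sub>C symbol_lie (b, n) (a, m))"
proof -
  obtain N where N: "\<forall>k\<ge>N. lbr b a k = 0" "\<forall>k\<ge>N. lbr a b k = 0"
    using lbr_bound2[of b a a b] by blast
  let ?c = "\<lambda>q k. (of_int m gchoose q) * ((- 1) ^ q * (of_int (m + n - int q) gchoose (k - q)) :: complex)"
  let ?v = "\<lambda>k. mode (nprod b k a) (m + n - int k)"
  have coeff: "(of_int m gchoose q) *\<^sub>C mode (nprod a q b) (m + n - int q) =
      - (koszul i j *\<^sub>C (\<Sum>k<N. if q \<le> k then ?c q k *\<^sub>C ?v k else 0))" for q
  proof -
    have 1: "fact q *\<^sub>C mode (((- 1) ^ k * of_nat (k choose q)) *\<^sub>C (del ^^ (k - q)) (lbr b a k)) (m + n - int q) =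
       (if q \<le> k then ((- 1) ^ q * (of_int (m + n - int q) gchoose (k - q))) *\<^sub>C ?v k else 0)" for k
    proof (cases "q \<le> k")
      case True
      have key: "fact q * ((- 1) ^ k * of_nat (k choose q)) * ((- 1) ^ (k - q) * fact (k - q)) = (- 1) ^ q * (fact k :: complex)"
      proof -
        have "fact q * fact (k - q) * of_nat (k choose q) = (fact k :: complex)"
          using binomial_fact_lemma[OF True] by (metis of_nat_fact of_nat_mult)
        moreover have "(- 1 :: complex) ^ k * (- 1) ^ (k - q) = (- 1) ^ q"
        proof -
          have "(- 1 :: complex) ^ k = (- 1) ^ q * (- 1) ^ (k - q)"
            using True by (simp flip: power_add)
          then show ?thesis by (simp flip: power_mult_distrib)
        qed
        moreover have "fact q * ((- 1) ^ k * of_nat (k choose q)) * ((- 1) ^ (k - q) * fact (k - q)) =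
           ((- 1) ^ k * (- 1) ^ (k - q)) * (fact q * fact (k - q) * of_nat (k choose q) :: complex)"
          by (simp only: mult_ac)
        ultimately show ?thesis by simp
      qed
      have "fact q * ((- 1) ^ k * of_nat (k choose q)) * ((- 1) ^ (k - q) * fact (k - q) * g) = (- 1) ^ q * g * (fact k :: complex)" for g
        using arg_cong[OF key, of "\<lambda>z. z * g"] by (simp only: mult_ac)
      moreover have "m + n - int q - int (k - q) = m + n - int k" using True by simp
      ultimately show ?thesis
        using True by (simp only: mode_scale mode_del_power scaleC_scaleC nprod_def if_True mult.assoc)
    qed (simp add: binomial_eq_0)
    have "nprod a q b = - (koszul i j *\<^sub>C
      (\<Sum>k<N. fact q *\<^sub>C ((- 1) ^ k * of_nat (k choose q)) *\<^sub>C (del ^^ (k - q)) (lbr b a k)))"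
      unfolding nprod_def
      by (subst lbr_skew_coeff[OF assms, of N])
        (use N in \<open>simp_all add: cvec.scale_minus_right cvec.scale_sum_right scaleC_scaleC mult_ac\<close>)
    then have "mode (nprod a q b) (m + n - int q) = - (koszul i j *\<^sub>C
      (\<Sum>k<N. fact q *\<^sub>C mode (((- 1) ^ k * of_nat (k choose q)) *\<^sub>C (del ^^ (k - q)) (lbr b a k)) (m + n - int q)))"
      by (simp only: mode_neg mode_scale mode_sum)
    also have "\<dots> = - (koszul i j *\<^sub>C
      (\<Sum>k<N. if q \<le> k then ((- 1) ^ q * (of_int (m + n - int q) gchoose (k - q))) *\<^sub>C ?v k else 0))"
      unfolding 1 ..
    finally have fin: "mode (nprod a q b) (m + n - int q) = \<dots>" .
    show ?thesis
      unfolding fin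
      by (simp add: cvec.scale_minus_right cvec.scale_sum_right scaleC_scaleC if_distrib mult_ac cong: if_cong)
  qed
  have "symbol_lie (a, m) (b, n) = - (koszul i j *\<^sub>C (\<Sum>q<N. \<Sum>k<N. if q \<le> k then ?c q k *\<^sub>C ?v k else 0))"
    by (subst symbol_lie_bound[of N]) (use N in \<open>simp_all add: coeff sum_negf cvec.scale_sum_right\<close>)
  also have "(\<Sum>q<N. \<Sum>k<N. if q \<le> k then ?c q k *\<^sub>C ?v k else 0) = (\<Sum>k<N. (\<Sum>q\<le>k. ?c q k) *\<^sub>C ?v k)"
  proof (subst sum.swap, rule sum.cong)
    fix k assume "k \<in> {..<N}"
    then have "(\<Sum>q<N. if q \<le> k then ?c q k *\<^sub>C ?v k else 0) = (\<Sum>q\<le>k. ?c q k *\<^sub>C ?v k)"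
      by (intro sum.mono_neutral_cong_right) auto
    then show "(\<Sum>q<N. if q \<le> k then ?c q k *\<^sub>C ?v k else 0) = (\<Sum>q\<le>k. ?c q k) *\<^sub>C ?v k"
      by (simp add: cvec.scale_sum_left)
  qed simp
  also have "\<dots> = (\<Sum>k<N. (of_int n gchoose k) *\<^sub>C mode (nprod b k a) (n + m - int k))"
    using skew_coeff[where m = "of_int m" and n = "of_int n"] by (simp add: mult_ac add.commute)
  also have "\<dots> = symbol_lie (b, n) (a, m)"
    by (subst symbol_lie_bound[of N]) (use N in auto)
  finally show ?thesis .
qed

lemma nprod_jacobi:
  fixes a b c :: "'a::lie_conformal_superalgebra"
  assumes "a \<in> homog i" "b \<in> homog j"
  shows "nprod a p (nprod b q c) - koszul i j *\<^sub>C nprod b q (nprod a p c) =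
    (\<Sum>l\<le>p. of_nat (p choose l) *\<^sub>C nprod (nprod a l b) (p + q - l) c)"
proof -
  have "nprod a p (nprod b q c) - koszul i j *\<^sub>C nprod b q (nprod a p c) =
    (fact p * fact q) *\<^sub>C (lbr a (lbr b c q) p - koszul i j *\<^sub>C lbr b (lbr a c p) q)"
    by (simp add: nprod_def lbr_scale_right scaleC_scaleC cvec.scale_right_diff_distrib mult_ac)
  also have "\<dots> = (\<Sum>l\<le>p. (fact p * fact q * of_nat ((p + q - l) choose q)) *\<^sub>C lbr (lbr a b l) c (p + q - l))"
    unfolding lbr_jacobi_coeff[OF assms] by (simp add: cvec.scale_sum_right scaleC_scaleC)
  also have "\<dots> = (\<Sum>l\<le>p. of_nat (p choose l) *\<^sub>C nprod (nprod a l b) (p + q - l) c)"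
  proof (rule sum.cong)
    fix l assume "l \<in> {..p}"
    then have l: "l \<le> p" "q \<le> p + q - l" by auto
    have e1: "fact q * fact (p + q - l - q) * of_nat ((p + q - l) choose q) = (fact (p + q - l) :: complex)"
      using binomial_fact_lemma[OF l(2)] by (metis of_nat_fact of_nat_mult)
    have e2: "fact l * fact (p - l) * of_nat (p choose l) = (fact p :: complex)"
      using binomial_fact_lemma[OF l(1)] by (metis of_nat_fact of_nat_mult)
    have idx: "p + q - l - q = p - l" by simp
    have "fact p * fact q * of_nat ((p + q - l) choose q) * (fact (p - l) :: complex) =
        of_nat (p choose l) * fact l * fact (p + q - l) * fact (p - l)"
      unfolding e1[symmetric] e2[symmetric] idx by (simp only: mult_ac)
    then have "fact p * fact q * of_nat ((p + q - l) choose q) =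
        of_nat (p choose l) * (fact (p + q - l) * fact l :: complex)"
      by simp
    then show "(fact p * fact q * of_nat ((p + q - l) choose q)) *\<^sub>C lbr (lbr a b l) c (p + q - l) =
        of_nat (p choose l) *\<^sub>C nprod (nprod a l b) (p + q - l) c"
      by (simp add: nprod_def lbr_scale_left scaleC_scaleC)
  qed simp
  finally show ?thesis .
qed

lemma clinear_lie_left: "clinear (\<lambda>x. annih_lie x y)" and clinear_lie_right: "clinear (annih_lie y)"
  by (unfold_locales; simp add: annih_lie_hom)+

lemma nprod_eventually_0: "\<forall>\<^sub>F k in sequentially. nprod a k b = (0::'a::lie_conformal_superalgebra)"
  using lbr_eventually_0[of a b] by (simp add: nprod_zero_iff)

lemma symbol_jacobi:
  fixes a b c :: "'a::lie_conformal_superalgebra"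
  assumes "a \<in> homog i" "b \<in> homog j"
  shows "annih_lie (mode a m) (annih_lie (mode b n) (mode c k)) =
    annih_lie (annih_lie (mode a m) (mode b n)) (mode c k) +
    koszul i j *\<^sub>C annih_lie (mode b n) (annih_lie (mode a m) (mode c k))"
proof -
  have "\<forall>\<^sub>F p in sequentially. nprod b p c = 0 \<and> nprod a p c = 0 \<and> nprod a p b = 0"
    by (intro eventually_conj nprod_eventually_0)
  then obtain N0 where N0: "\<And>p. p \<ge> N0 \<Longrightarrow> nprod b p c = 0 \<and> nprod a p c = 0 \<and> nprod a p b = 0"
    unfolding eventually_sequentially by blast
  have "\<forall>\<^sub>F r in sequentially. \<forall>p\<in>{..<N0}.
      nprod a r (nprod b p c) = 0 \<and> nprod b r (nprod a p c) = 0 \<and> nprod (nprod a p b) r c = 0"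
    by (intro eventually_ball_finite ballI eventually_conj nprod_eventually_0) simp
  then obtain N1 where N1: "\<And>p r. p < N0 \<Longrightarrow> r \<ge> N1 \<Longrightarrow>
      nprod a r (nprod b p c) = 0 \<and> nprod b r (nprod a p c) = 0 \<and> nprod (nprod a p b) r c = 0"
    unfolding eventually_sequentially by blast
  define N where "N = N0 + N1"
  have z1: "nprod b p c = 0" "nprod a p c = 0" "nprod a p b = 0" if "p \<ge> N" for p
    using N0[of p] that by (simp_all add: N_def)
  have z: "nprod a r (nprod b p c) = 0 \<and> nprod b r (nprod a p c) = 0 \<and> nprod (nprod a p b) r c = 0"
    if "N \<le> r" for p r
  proof (cases "p < N0")
    case True
    then show ?thesis using N1 that by (simp add: N_def)
  next
    case False
    then show ?thesis using N0[of p] by (simp add: nprod_def)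
  qed
  have zc: "l < N \<and> r < N" if "nprod (nprod a l b) r c \<noteq> 0" for l r
    using that z[of r l] z1(3)[of l] by (cases "N \<le> r"; cases "N \<le> l"; simp add: nprod_def)
  have bound: "annih_lie (mode x u) (mode y v) =
      (\<Sum>p<M. (of_int u gchoose p) *\<^sub>C mode (nprod x p y) (u + v - int p))"
    if "\<And>p. p \<ge> M \<Longrightarrow> nprod x p y = 0" for x y :: 'a and u v M
    unfolding annih_lie_mode by (rule symbol_lie_bound) (use that in \<open>simp add: nprod_zero_iff\<close>)
  define M where "M = 2 * N"
  have NM: "N \<le> M" by (simp add: M_def)
  let ?I = "\<lambda>p q. m + n + k - int p - int q"
  have A: "annih_lie (mode a m) (annih_lie (mode b n) (mode c k)) =
      (\<Sum>p<M. \<Sum>q<M. ((of_int m gchoose p) * (of_int n gchoose q)) *\<^sub>C mode (nprod a p (nprod b q c)) (?I p q))"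
  proof -
    have "annih_lie (mode b n) (mode c k) = (\<Sum>q<M. (of_int n gchoose q) *\<^sub>C mode (nprod b q c) (n + k - int q))"
      by (rule bound) (use z1 NM in simp)
    then have "annih_lie (mode a m) (annih_lie (mode b n) (mode c k)) =
      (\<Sum>q<M. (of_int n gchoose q) *\<^sub>C annih_lie (mode a m) (mode (nprod b q c) (n + k - int q)))"
      by (simp add: module_hom.sum[OF clinear_lie_right] annih_lie_hom)
    also have "\<dots> = (\<Sum>q<M. \<Sum>p<M. ((of_int m gchoose p) * (of_int n gchoose q)) *\<^sub>C mode (nprod a p (nprod b q c)) (?I p q))"
      by (subst bound[where M = M])
        (use z NM in \<open>simp_all add: cvec.scale_sum_right scaleC_scaleC algebra_simps\<close>)
    finally show ?thesis by (subst (asm) sum.swap)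
  qed
  have B: "annih_lie (mode b n) (annih_lie (mode a m) (mode c k)) =
      (\<Sum>p<M. \<Sum>q<M. ((of_int m gchoose p) * (of_int n gchoose q)) *\<^sub>C mode (nprod b q (nprod a p c)) (?I p q))"
  proof -
    have "annih_lie (mode a m) (mode c k) = (\<Sum>p<M. (of_int m gchoose p) *\<^sub>C mode (nprod a p c) (m + k - int p))"
      by (rule bound) (use z1 NM in simp)
    then have "annih_lie (mode b n) (annih_lie (mode a m) (mode c k)) =
      (\<Sum>p<M. (of_int m gchoose p) *\<^sub>C annih_lie (mode b n) (mode (nprod a p c) (m + k - int p)))"
      by (simp add: module_hom.sum[OF clinear_lie_right] annih_lie_hom)
    also have "\<dots> = (\<Sum>p<M. \<Sum>q<M. ((of_int m gchoose p) * (of_int n gchoose q)) *\<^sub>C mode (nprod b q (nprod a p c)) (?I p q))"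
      by (subst bound[where M = M])
        (use z NM in \<open>simp_all add: cvec.scale_sum_right scaleC_scaleC algebra_simps\<close>)
    finally show ?thesis .
  qed
  let ?T = "\<lambda>l r. mode (nprod (nprod a l b) r c) (?I l r)"
  let ?F = "\<lambda>p q l. ((of_int m gchoose p) * (of_int n gchoose q) * of_nat (p choose l)) *\<^sub>C ?T l (p + q - l)"
  let ?G = "\<lambda>l r u. ((of_int m gchoose (l + u)) * (of_int n gchoose (r - u)) * of_nat ((l + u) choose l)) *\<^sub>C ?T l r"
  have "annih_lie (mode a m) (annih_lie (mode b n) (mode c k)) -
      koszul i j *\<^sub>C annih_lie (mode b n) (annih_lie (mode a m) (mode c k)) =
      (\<Sum>p<M. \<Sum>q<M. ((of_int m gchoose p) * (of_int n gchoose q)) *\<^sub>C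
         mode (nprod a p (nprod b q c) - koszul i j *\<^sub>C nprod b q (nprod a p c)) (?I p q))"
    unfolding A B cvec.scale_sum_right sum_subtractf[symmetric]
    by (simp add: mode_diff mode_scale cvec.scale_right_diff_distrib scaleC_scaleC mult_ac)
  also have "\<dots> = (\<Sum>p<M. \<Sum>q<M. \<Sum>l\<le>p. ?F p q l)"
    unfolding nprod_jacobi[OF assms] mode_sum mode_scale cvec.scale_sum_right scaleC_scaleC
    by (intro sum.cong refl) (auto simp: of_nat_diff algebra_simps)
  also have "\<dots> = (\<Sum>(p, q, l)\<in>(SIGMA p:{..<M}. SIGMA q:{..<M}. {..p}). ?F p q l)"
    by (rule sum_Sigma3) auto
  also have "\<dots> = (\<Sum>(p, q, l)\<in>{(p, q, l). l < N \<and> l \<le> p \<and> p + q - l < N}. ?F p q l)"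
  proof (rule sum.mono_neutral_right)
    show "{(p, q, l). l < N \<and> l \<le> p \<and> p + q - l < N} \<subseteq> (SIGMA p:{..<M}. SIGMA q:{..<M}. {..p})"
      by (auto simp: M_def)
    show "\<forall>s\<in>(SIGMA p:{..<M}. SIGMA q:{..<M}. {..p}) - {(p, q, l). l < N \<and> l \<le> p \<and> p + q - l < N}.
        (case s of (p, q, l) \<Rightarrow> ?F p q l) = 0"
    proof
      fix s assume s: "s \<in> (SIGMA p:{..<M}. SIGMA q:{..<M}. {..p}) - {(p, q, l). l < N \<and> l \<le> p \<and> p + q - l < N}"
      obtain p q l where [simp]: "s = (p, q, l)" by (cases s)
      from s have "\<not> (l < N \<and> p + q - l < N)" by auto
      then have "nprod (nprod a l b) (p + q - l) c = 0" using zc by blast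
      then show "(case s of (p, q, l) \<Rightarrow> ?F p q l) = 0" by simp
    qed
  qed simp
  also have "\<dots> = (\<Sum>(l, r, u)\<in>(SIGMA l:{..<N}. SIGMA r:{..<N}. {..r}). ?G l r u)"
    by (rule sum.reindex_bij_witness[where i = "\<lambda>(l, r, u). (l + u, r - u, l)"
          and j = "\<lambda>(p, q, l). (l, p + q - l, p - l)"]) auto
  also have "\<dots> = (\<Sum>l<N. \<Sum>r<N. (\<Sum>u\<le>r. (of_int m gchoose (l + u)) * (of_int n gchoose (r - u)) *
      of_nat ((l + u) choose l)) *\<^sub>C ?T l r)"
    by (simp add: sum.Sigma cvec.scale_sum_left)
  also have "\<dots> = (\<Sum>l<N. \<Sum>r<N. ((of_int m gchoose l) * (of_int (m + n - int l) gchoose r)) *\<^sub>C ?T l r)"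
  proof -
    have "(\<Sum>u\<le>r. (of_int m gchoose (l + u)) * (of_int n gchoose (r - u)) * of_nat ((l + u) choose l)) =
       (of_int m gchoose l) * (of_int (m + n - int l) gchoose r :: complex)" for l r
    proof -
      have "(of_int m gchoose (l + u)) * (of_int n gchoose (r - u)) * of_nat ((l + u) choose l) =
        (of_int m gchoose l) * ((of_int m - of_nat l gchoose u) * (of_int n gchoose (r - u)) :: complex)" for u
        using gbinomial_trinomial_revision[of l "l + u" "of_int m :: complex"]
        by (simp add: binomial_gbinomial mult_ac)
      then have "(\<Sum>u\<le>r. (of_int m gchoose (l + u)) * (of_int n gchoose (r - u)) * of_nat ((l + u) choose l)) =
        (of_int m gchoose l) * (\<Sum>u\<in>{0..r}. (of_int m - of_nat l gchoose u) * (of_int n gchoose (r - u)) :: complex)"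
        by (simp only: sum_distrib_left atLeast0AtMost)
      also have "\<dots> = (of_int m gchoose l) * (of_int (m + n - int l) gchoose r)"
        unfolding gbinomial_Vandermonde by (simp add: algebra_simps)
      finally show ?thesis .
    qed
    then show ?thesis by simp
  qed
  also have "\<dots> = annih_lie (annih_lie (mode a m) (mode b n)) (mode c k)"
  proof -
    have "annih_lie (mode a m) (mode b n) = (\<Sum>l<N. (of_int m gchoose l) *\<^sub>C mode (nprod a l b) (m + n - int l))"
      by (rule bound) (use z1 in simp)
    then have "annih_lie (annih_lie (mode a m) (mode b n)) (mode c k) =
      (\<Sum>l<N. (of_int m gchoose l) *\<^sub>C annih_lie (mode (nprod a l b) (m + n - int l)) (mode c k))"
      by (simp add: module_hom.sum[OF clinear_lie_left] annih_lie_hom)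
    also have "\<dots> = (\<Sum>l<N. \<Sum>r<N. ((of_int m gchoose l) * (of_int (m + n - int l) gchoose r)) *\<^sub>C ?T l r)"
      by (subst bound[where M = N])
        (use z in \<open>simp_all add: cvec.scale_sum_right scaleC_scaleC algebra_simps\<close>)
    finally show ?thesis ..
  qed
  finally show ?thesis by (simp add: diff_eq_eq)
qed

lemma mode_nprod_homog: "a \<in> homog i \<Longrightarrow> b \<in> homog j \<Longrightarrow> mode (nprod a p b) n \<in> homog (i + j)"
  unfolding nprod_def by (intro mode_homog homog_scale lbr_homog)

instantiation annih :: (lie_conformal_superalgebra) lie_superalgebra
begin

definition lie_annih :: "'a annih \<Rightarrow> 'a annih \<Rightarrow> 'a annih" where "lie_annih = annih_lie"

instance
proof
  fix x y z :: "'a annih" and c :: complex and i j :: bit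
  show "lie (x + y) z = lie x z + lie y z" "lie x (y + z) = lie x y + lie x z"
    "lie (c *\<^sub>C x) y = c *\<^sub>C lie x y" "lie x (c *\<^sub>C y) = c *\<^sub>C lie x y"
    by (simp_all add: lie_annih_def annih_lie_hom)
  show "lie x y \<in> homog (i + j)" if x: "x \<in> homog i" and y: "y \<in> homog j"
  proof -
    have 1: "annih_lie (mode a m) (mode b n) \<in> homog (i + j)" if "a \<in> homog i" "b \<in> homog j" for a b :: 'a and m n
      unfolding annih_lie_mode symbol_lie_def prod.case
      by (intro cvec.subspace_sum[OF csubspace_homog] homog_scale mode_nprod_homog that)
    have 2: "annih_lie (mode a m) y \<in> homog (i + j)" if "a \<in> homog i" for a :: 'a and m
      using y unfolding homog_annih_def[of j]
    proof (induction rule: cvec.span_induct_alt)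
      case base
      show ?case by (simp add: module_hom.zero[OF clinear_lie_right] homog_zero)
    next
      case (step c x y)
      then show ?case using 1 that by (auto simp: annih_lie_hom intro!: homog_add homog_scale)
    qed
    show ?thesis
      using x unfolding homog_annih_def[of i] lie_annih_def
    proof (induction rule: cvec.span_induct_alt)
      case base
      show ?case by (simp add: module_hom.zero[OF clinear_lie_left] homog_zero)
    next
      case (step c x y)
      then show ?case using 2 by (auto simp: annih_lie_hom intro!: homog_add homog_scale)
    qed
  qed
  show "lie x y = - (koszul i j *\<^sub>C lie y x)" if x: "x \<in> homog i" and y: "y \<in> homog j"
    unfolding lie_annih_def
  proof (rule annih_eq_on_homog[OF _ _ _ x])
    show "clinear (\<lambda>x. annih_lie x y)" "clinear (\<lambda>x. - (koszul i j *\<^sub>C annih_lie y x))"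
      by (unfold_locales; simp add: annih_lie_hom scaleC_add_right cvec.scale_left_commute cvec.scale_minus_right)+
    fix a :: 'a and m assume a: "a \<in> homog i"
    show "annih_lie (mode a m) y = - (koszul i j *\<^sub>C annih_lie y (mode a m))"
    proof (rule annih_eq_on_homog[OF _ _ _ y])
      show "clinear (annih_lie (mode a m))" "clinear (\<lambda>y. - (koszul i j *\<^sub>C annih_lie y (mode a m)))"
        by (unfold_locales; simp add: annih_lie_hom scaleC_add_right cvec.scale_left_commute cvec.scale_minus_right)+
    qed (simp add: annih_lie_mode symbol_lie_skew[OF a])
  qed
  show "lie x (lie y z) = lie (lie x y) z + koszul i j *\<^sub>C lie y (lie x z)"
    if x: "x \<in> homog i" and y: "y \<in> homog j"
    unfolding lie_annih_def
  proof (rule annih_eq_on_homog[OF _ _ _ x])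
    show "clinear (\<lambda>x. annih_lie x (annih_lie y z))"
      "clinear (\<lambda>x. annih_lie (annih_lie x y) z + koszul i j *\<^sub>C annih_lie y (annih_lie x z))"
      by (unfold_locales; simp add: annih_lie_hom scaleC_add_right cvec.scale_left_commute add_ac)+
    fix a :: 'a and m assume a: "a \<in> homog i"
    show "annih_lie (mode a m) (annih_lie y z) =
        annih_lie (annih_lie (mode a m) y) z + koszul i j *\<^sub>C annih_lie y (annih_lie (mode a m) z)"
    proof (rule annih_eq_on_homog[OF _ _ _ y])
      show "clinear (\<lambda>y. annih_lie (mode a m) (annih_lie y z))"
        "clinear (\<lambda>y. annih_lie (annih_lie (mode a m) y) z + koszul i j *\<^sub>C annih_lie y (annih_lie (mode a m) z))"
        by (unfold_locales; simp add: annih_lie_hom scaleC_add_right cvec.scale_left_commute add_ac)+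
      fix b :: 'a and n assume b: "b \<in> homog j"
      show "annih_lie (mode a m) (annih_lie (mode b n) z) =
        annih_lie (annih_lie (mode a m) (mode b n)) z + koszul i j *\<^sub>C annih_lie (mode b n) (annih_lie (mode a m) z)"
      proof (rule annih_eq_on_UNIV[where x = z])
        show "clinear (\<lambda>z. annih_lie (mode a m) (annih_lie (mode b n) z))"
          "clinear (\<lambda>z. annih_lie (annih_lie (mode a m) (mode b n)) z + koszul i j *\<^sub>C annih_lie (mode b n) (annih_lie (mode a m) z))"
          by (unfold_locales; simp add: annih_lie_hom scaleC_add_right cvec.scale_left_commute add_ac)+
      qed (rule symbol_jacobi[OF a b])
    qed
  qed
qed

end

lemma lie_mode:
  "lie (mode a m) (mode b n) =
    (\<Sum>j | nprod a j b \<noteq> 0. (of_int m gchoose j) *\<^sub>C mode (nprod a j b) (m + n - int j))"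
  by (simp add: lie_annih_def annih_lie_mode symbol_lie_def)

end

theory Submission
  imports Defs
begin

text \<open>
  The relations reduce every \<open>(\<partial>\<^sup>i x)\<^sub>(\<^sub>n\<^sub>)\<close> to \<open>(-1)\<^sup>i n(n-1)\<dots>(n-i+1) x\<^sub>(\<^sub>n\<^sub>-\<^sub>i\<^sub>)\<close>, so the modes of
  \<open>L\<close>, \<open>W\<close>, \<open>G\<close> span; reading off the coefficient of \<open>x\<^sub>(\<^sub>k\<^sub>)\<close> in this reduction respects the relations
  and gives linear functionals dual to these modes, which are therefore independent.
  A bracket \<open>[a\<^sub>\<lambda> b] = c + \<lambda> d\<close> gives \<open>[a\<^sub>(\<^sub>m\<^sub>), b\<^sub>(\<^sub>n\<^sub>)] = c\<^sub>(\<^sub>m\<^sub>+\<^sub>n\<^sub>) + m d\<^sub>(\<^sub>m\<^sub>+\<^sub>n\<^sub>-\<^sub>1\<^sub>)\<close>, and the asserted brackets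
  hold for \<open>L\<^sub>m = - L\<^sub>(\<^sub>m\<^sub>+\<^sub>1\<^sub>)\<close>, \<open>W\<^sub>m = - W\<^sub>(\<^sub>m\<^sub>-\<^sub>1\<^sub>)\<close>, \<open>G\<^sub>m = G\<^sub>(\<^sub>m\<^sub>)\<close>.
\<close>

text \<open>If \<open>b i\<close> lay in the span of the other vectors, \<open>\<phi> i\<close>,
  which kills them all, would kill \<open>b i\<close> too. Nonzero diagonal values suffice; they
  will be -1 where a basis vector carries a sign.\<close>

lemma dual_family:
  fixes b :: "'i \<Rightarrow> 'v::complex_vector" and \<phi> :: "'i \<Rightarrow> 'v \<Rightarrow> complex"
  assumes \<phi>: "\<And>i. clinear (\<phi> i)"
    and diag: "\<And>i. \<phi> i (b i) \<noteq> 0"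
    and off_diag: "\<And>i j. i \<noteq> j \<Longrightarrow> \<phi> i (b j) = 0"
  shows "inj b" and "\<not> cdependent (range b)"
proof -
  show "inj b"
    by (rule injI) (metis diag off_diag)
  show "\<not> cdependent (range b)"
  proof
    assume "cdependent (range b)"
    then obtain i where i: "b i \<in> cspan (range b - {b i})"
      unfolding cvec.dependent_def by blast
    have "\<phi> i (b i) = 0"
    proof (rule module_hom.eq_0_on_span[OF \<phi> _ i[unfolded cspan_def]])
      show "\<phi> i x = 0" if "x \<in> range b - {b i}" for x
        using that off_diag[of i] by (metis Diff_iff imageE singletonI)
    qed
    with diag show False by blast
  qed
qed

text \<open>Universal property of the quotient: the hypotheses make the linear extension of
  \<open>f\<close> to formal combinations vanish on all three families of relators.\<close>

lemma annih_extend: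
  fixes f :: "'a::lie_conformal_superalgebra \<Rightarrow> int \<Rightarrow> 'v::complex_vector"
  assumes f: "\<And>n. clinear (\<lambda>a. f a n)"
    and f_del: "\<And>a n. f (del a) n = - of_int n *\<^sub>C f a (n - 1)"
  shows "\<exists>F. clinear F \<and> (\<forall>a n. F (mode a n) = f a n)"
proof -
  let ?f = "free_ext (\<lambda>(a, n). f a n)"
  have relators: "?f r = 0" if "r \<in> cspan annih_relators" for r
  proof (rule module_hom.eq_0_on_span[OF clinear_free_ext _ that[unfolded cspan_def]])
    fix q :: "('a \<times> int) \<Rightarrow>\<^sub>0 complex" assume "q \<in> annih_relators"
    then show "?f q = 0"
      unfolding annih_relators_def
      by (auto simp: free_ext_hom free_ext_single scaleC_one f_del module_hom.add[OF f]
          module_hom.scale[OF f] cvec.scale_minus_left)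
  qed
  \<comment> \<open>The choice of representative is harmless: two of them differ by an element of
    the span of the relators, where \<open>?f\<close> vanishes.\<close>
  define F where "F x = ?f (rep_annih x)" for x
  have F: "F (abs_annih y) = ?f y" for y
  proof -
    have "rep_annih (abs_annih y) - y \<in> cspan annih_relators"
      by (rule Quotient3_rep_abs[OF Quotient3_annih]) (simp add: cvec.span_zero)
    from relators[OF this] show ?thesis by (simp add: F_def free_ext_hom)
  qed
  have "clinear F"
  proof unfold_locales
    fix x y :: "'a annih" and c :: complex
    show "F (x + y) = F x + F y"
      by (induction x rule: annih.abs_induct, induction y rule: annih.abs_induct)
        (simp add: plus_annih.abs_eq F free_ext_hom)
    show "F (c *\<^sub>C x) = c *\<^sub>C F x"
      by (induction x rule: annih.abs_induct) (simp add: scaleC_annih.abs_eq F free_ext_hom)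
  qed
  moreover have "F (mode a n) = f a n" for a n
    by (simp add: mode.abs_eq F free_ext_single scaleC_one)
  ultimately show ?thesis by blast
qed

text \<open>The coefficient of \<open>x\<^sub>(\<^sub>k\<^sub>)\<close> in \<open>(p(\<partial>) x)\<^sub>(\<^sub>n\<^sub>)\<close>.\<close>

definition mode_coeff :: "int \<Rightarrow> complex poly \<Rightarrow> int \<Rightarrow> complex" where
  "mode_coeff k p n = (if k \<le> n
     then (let i = nat (n - k) in (- 1) ^ i * fact i * (of_int n gchoose i) * coeff p i) else 0)"

lemma mode_coeff_hom:
  "mode_coeff k (p + q) n = mode_coeff k p n + mode_coeff k q n"
  "mode_coeff k (smult c p) n = c * mode_coeff k p n"
  "mode_coeff k 0 n = 0"
  by (simp_all add: mode_coeff_def Let_def algebra_simps)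

lemma mode_coeff_one: "mode_coeff k 1 n = (if n = k then 1 else 0)"
  by (simp add: mode_coeff_def Let_def)

text \<open>\<open>pCons 0\<close> is multiplication by \<partial>, so this is the compatibility
  that \<open>annih_extend\<close> demands. It rests on the absorption identity for binomial
  coefficients.\<close>

lemma mode_coeff_shift: "mode_coeff k (pCons 0 p) n = - of_int n * mode_coeff k p (n - 1)"
proof (cases "k \<le> n - 1")
  case True
  define j where "j = nat (n - 1 - k)"
  have j: "nat (n - k) = Suc j" "nat (n - 1 - k) = j"
    using True by (simp_all add: j_def)
  have "mode_coeff k (pCons 0 p) n
      = (- 1) ^ Suc j * fact j * ((of_int n gchoose Suc j) * of_nat (Suc j)) * coeff p j"
    using True unfolding mode_coeff_def Let_def j by simp
  also have "\<dots> = - of_int n * mode_coeff k p (n - 1)"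
    unfolding gbinomial_Suc_absorb mode_coeff_def Let_def j using True by simp
  finally show ?thesis .
next
  case False
  then show ?thesis
    \<comment> \<open>For \<open>k = n\<close> the left side reads the constant coefficient of
      \<open>pCons 0 p\<close>, which is 0.\<close>
    by (cases "k = n") (simp_all add: mode_coeff_def)
qed

lemma mode_functional:
  fixes c :: "S \<Rightarrow> complex poly"
  assumes "c \<in> {cL, cW, cG}"
  shows "\<exists>F. clinear F \<and> (\<forall>a n. F (mode a n) = mode_coeff k (c a) n)"
proof (rule annih_extend)
  show "clinear (\<lambda>a. mode_coeff k (c a) n)" for n
    using assms by unfold_locales (auto simp: mode_coeff_hom scaleC_complex_def)
  show "mode_coeff k (c (del a)) n = - of_int n *\<^sub>C mode_coeff k (c a) (n - 1)" for a n
    using assms by (auto simp: del_S_def mode_coeff_shift scaleC_complex_def)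
qed

text \<open>The hypotheses are Horner's rule for \<open>h p\<close> = p(\<partial>)x. Modes of
  \<open>del (h p)\<close> are multiples of modes of \<open>h p\<close> with index lowered by one,
  hence the induction over all \<open>n\<close>.\<close>

lemma mode_in_span:
  fixes h :: "complex poly \<Rightarrow> 'a::lie_conformal_superalgebra"
  assumes "h 0 = 0" and h: "\<And>c p. h (pCons c p) = c *\<^sub>C x + del (h p)"
  shows "mode (h p) n \<in> cspan (range (mode x))"
proof (induction p arbitrary: n)
  case 0
  then show ?case by (simp add: assms(1) cvec.span_zero)
next
  case (pCons c p)
  then show ?case
    by (simp add: h mode_add mode_scale mode_del cvec.span_add cvec.span_diff cvec.span_scale cvec.span_base)
qed

lemma lie_mode_linear:
  fixes a b c d :: "'a::lie_conformal_superalgebra"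
  assumes "\<And>l. lbr_at a l b = c + l *\<^sub>C d"
  shows "lie (mode a m) (mode b n) = mode c (m + n) + of_int m *\<^sub>C mode d (m + n - 1)"
proof -
  obtain N where N: "\<And>j. j \<ge> N \<Longrightarrow> lbr a b j = 0"
    using lbr_bound[of a b] by blast
  let ?g = "\<lambda>j::nat. if j = 0 then c else if j = 1 then d else 0"
  \<comment> \<open>The bound is raised by 2 so that the coefficients 0 and 1 are always in
    range.\<close>
  have N': "lbr a b j = 0" if "j \<ge> N + 2" for j
    using N that by simp
  have sum2: "(\<Sum>j<N + 2. f j) = f 0 + f 1" if "\<And>j. f (Suc (Suc j)) = 0" for f :: "nat \<Rightarrow> 'v::ab_group_add"
    using that by (simp add: sum.lessThan_Suc_shift del: sum.lessThan_Suc)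
  have g: "lbr a b j = ?g j" if "j < N + 2" for j
  proof (rule coeffs_eqI[OF _ that])
    show "(\<Sum>j<N + 2. l ^ j *\<^sub>C lbr a b j) = (\<Sum>j<N + 2. l ^ j *\<^sub>C ?g j)" for l
      by (subst (2) sum2)
        (simp_all add: lbr_at_bound[OF N', symmetric] assms scaleC_one del: sum.lessThan_Suc)
  qed
  have "lbr a b (Suc (Suc j)) = 0" for j
    using g[of "Suc (Suc j)"] N'[of "Suc (Suc j)"] by (cases "Suc (Suc j) < N + 2") auto
  then have "symbol_lie (a, m) (b, n) = (of_int m gchoose 0) *\<^sub>C mode (nprod a 0 b) (m + n - int 0)
      + (of_int m gchoose 1) *\<^sub>C mode (nprod a 1 b) (m + n - int 1)"
    by (subst symbol_lie_bound[of "N + 2"], use N' in simp, subst sum2)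
      (simp_all add: nprod_def del: sum.lessThan_Suc)
  then show ?thesis
    by (simp add: lie_annih_def annih_lie_mode nprod_def g[of 0, simplified] g[of 1, simplified] scaleC_one)
qed

lemma S_mode_brackets:
  "lie (mode S_L m) (mode S_L n) = of_int (m - n) *\<^sub>C mode S_L (m + n - 1)"
  "lie (mode S_L m) (mode S_W n) = - of_int (m + n) *\<^sub>C mode S_W (m + n - 1)"
  "lie (mode S_L m) (mode S_G n) = - of_int n *\<^sub>C mode S_G (m + n - 1)"
  "lie (mode S_G m) (mode S_G n) = - of_int (m + n) *\<^sub>C mode S_W (m + n - 1)"
  "lie (mode S_W m) (mode S_W n) = 0"
  "lie (mode S_W m) (mode S_G n) = 0"
proof -
  show "lie (mode S_L m) (mode S_L n) = of_int (m - n) *\<^sub>C mode S_L (m + n - 1)"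
    \<comment> \<open>The coefficient is -(m + n) from \<open>del S_L\<close> plus 2m from the
      \<lambda>-term.\<close>
    by (subst lie_mode_linear[where c = "del S_L" and d = "2 *\<^sub>C S_L"])
      (simp_all add: S_lambda_brackets mode_del mode_scale scaleC_scaleC mult.commute
        flip: scaleC_add_left)
  show "lie (mode S_L m) (mode S_W n) = - of_int (m + n) *\<^sub>C mode S_W (m + n - 1)"
    by (subst lie_mode_linear[where c = "del S_W" and d = 0])
      (simp_all add: S_lambda_brackets mode_del)
  show "lie (mode S_L m) (mode S_G n) = - of_int n *\<^sub>C mode S_G (m + n - 1)"
    by (subst lie_mode_linear[where c = "del S_G" and d = S_G])
      (simp_all add: S_lambda_brackets mode_del flip: scaleC_add_left)
  show "lie (mode S_G m) (mode S_G n) = - of_int (m + n) *\<^sub>C mode S_W (m + n - 1)"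
    by (subst lie_mode_linear[where c = "del S_W" and d = 0])
      (simp_all add: S_lambda_brackets mode_del)
  show "lie (mode S_W m) (mode S_W n) = 0" "lie (mode S_W m) (mode S_G n) = 0"
    by (subst lie_mode_linear[where c = 0 and d = 0]; simp add: S_lambda_brackets)+
qed

lemma S_annih_span:
  "cspan (range (mode S_L) \<union> range (mode S_W) \<union> range (mode S_G)) = UNIV" (is "cspan ?B = _")
proof -
  have "mode a n \<in> cspan ?B" for a n
  proof -
    have "mode (Elt p 0 0) n \<in> cspan (range (mode S_L))" for p
      by (rule mode_in_span) (simp_all add: S_L_def del_S_def zero_S_def plus_S_def scaleC_S_def)
    moreover have "mode (Elt 0 p 0) n \<in> cspan (range (mode S_W))" for p
      by (rule mode_in_span) (simp_all add: S_W_def del_S_def zero_S_def plus_S_def scaleC_S_def)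
    moreover have "mode (Elt 0 0 p) n \<in> cspan (range (mode S_G))" for p
      by (rule mode_in_span) (simp_all add: S_G_def del_S_def zero_S_def plus_S_def scaleC_S_def)
    moreover have "cspan X \<subseteq> cspan ?B" if "X \<subseteq> ?B" for X
      using that by (rule cvec.span_mono)
    ultimately have "mode (Elt (cL a) 0 0) n + mode (Elt 0 (cW a) 0) n + mode (Elt 0 0 (cG a)) n \<in> cspan ?B"
      by (intro cvec.span_add) blast+
    moreover have "Elt (cL a) 0 0 + Elt 0 (cW a) 0 + Elt 0 0 (cG a) = a"
      by (simp add: plus_S_def)
    ultimately show ?thesis by (metis mode_add)
  qed
  then have "{mode a n | a n. True} \<subseteq> cspan ?B" by blast
  from cvec.span_minimal[OF this cvec.subspace_span] show ?thesis
    unfolding annih_span by blast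
qed

theorem lemma3p1:
  shows "\<exists>L W G :: int \<Rightarrow> S annih.
    (\<forall>m. L m \<in> homog 0 \<and> W m \<in> homog 0 \<and> G m \<in> homog 1) \<and>
    inj L \<and> inj W \<and> inj G \<and>
    range L \<inter> range W = {} \<and> range L \<inter> range G = {} \<and> range W \<inter> range G = {} \<and>
    \<not> cdependent (range L \<union> range W \<union> range G) \<and>
    cspan (range L \<union> range W \<union> range G) = UNIV \<and>
    (\<forall>m n.
      lie (L m) (L n) = of_int (n - m) *\<^sub>C L (m + n) \<and>
      lie (L m) (W n) = of_int (m + n) *\<^sub>C W (m + n) \<and>
      lie (L m) (G n) = of_int n *\<^sub>C G (m + n) \<and>
      lie (G m) (G n) = of_int (m + n) *\<^sub>C W (m + n) \<and>
      lie (W m) (W n) = 0 \<and>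
      lie (W m) (G n) = 0)"
proof -
  \<comment> \<open>Mode brackets land in index m + n - 1. Shifting \<open>L\<close> by +1 undoes
    this when \<open>L\<close> acts; the shift -1 of \<open>W\<close> fits the bracket of two
    \<open>G\<close>. The signs turn m - n into n - m and -(m + n) into m + n.\<close>
  define L where "L m = - mode S_L (m + 1)" for m
  define W where "W m = - mode S_W (m - 1)" for m
  define G where "G m = mode S_G m" for m
  obtain F where F: "\<And>c k. c \<in> {cL, cW, cG} \<Longrightarrow> clinear (F c k)"
    and F_mode: "\<And>c k a n. c \<in> {cL, cW, cG} \<Longrightarrow> F c k (mode a n) = mode_coeff k (c a) n"
    using mode_functional by metis
  have F_neg: "F c k (- x) = - F c k x" if "c \<in> {cL, cW, cG}" for c k x
    by (rule module_hom.neg[OF F[OF that]])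
  \<comment> \<open>With one family over a sum type, injectivity of \<open>b\<close> gives both the
    injectivity of \<open>L\<close>, \<open>W\<close>, \<open>G\<close> and the disjointness of
    their ranges.\<close>
  define b where "b = case_sum L (case_sum W G)"
  define \<phi> where "\<phi> = case_sum (\<lambda>m. F cL (m + 1)) (case_sum (\<lambda>m. F cW (m - 1)) (F cG))"
  have "clinear (\<phi> i)" for i
    using F by (auto simp: \<phi>_def split: sum.split)
  moreover have "\<phi> i (b i) \<noteq> 0" for i
    by (auto simp: \<phi>_def b_def L_def W_def G_def F_neg F_mode S_L_def S_W_def S_G_def
        mode_coeff_one split: sum.split)
  moreover have "\<phi> i (b j) = 0" if "i \<noteq> j" for i j
    using that
    by (auto simp: \<phi>_def b_def L_def W_def G_def F_neg F_mode S_L_def S_W_def S_G_def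
        mode_coeff_one mode_coeff_hom split: sum.split)
  ultimately have inj: "inj b" and indep: "\<not> cdependent (range b)"
    using dual_family by blast+
  have b: "L m = b (Inl m)" "W m = b (Inr (Inl m))" "G m = b (Inr (Inr m))" for m
    by (simp_all add: b_def)
  have range_b: "range b = range L \<union> range W \<union> range G"
    by (auto simp: b_def UNIV_sum image_Un image_image)
  have "inj L" "inj W" "inj G"
    by (auto intro!: injI simp: b inj_eq[OF inj])
  moreover have "range L \<inter> range W = {}" "range L \<inter> range G = {}" "range W \<inter> range G = {}"
    by (auto simp: b inj_eq[OF inj])
  moreover have "cspan (range L \<union> range W \<union> range G) = UNIV"
  proof -
    have "mode S_L n = - L (n - 1)" "mode S_W n = - W (n + 1)" "mode S_G n = G n" for n
      by (simp_all add: L_def W_def G_def)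
    then have "range (mode S_L) \<union> range (mode S_W) \<union> range (mode S_G)
        \<subseteq> cspan (range L \<union> range W \<union> range G)"
      by (auto intro!: cvec.span_neg intro: cvec.span_base)
    from cvec.span_minimal[OF this cvec.subspace_span] show ?thesis
      unfolding S_annih_span by blast
  qed
  moreover have "L m \<in> homog 0 \<and> W m \<in> homog 0 \<and> G m \<in> homog 1" for m
    unfolding L_def W_def G_def
    by (intro conjI cvec.subspace_neg[OF csubspace_homog] mode_homog)
      (simp_all add: homog_S_def S_L_def S_W_def S_G_def)
  moreover have "lie (L m) (L n) = of_int (n - m) *\<^sub>C L (m + n) \<and>
      lie (L m) (W n) = of_int (m + n) *\<^sub>C W (m + n) \<and>
      lie (L m) (G n) = of_int n *\<^sub>C G (m + n) \<and>
      lie (G m) (G n) = of_int (m + n) *\<^sub>C W (m + n) \<and>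
      lie (W m) (W n) = 0 \<and>
      lie (W m) (G n) = 0" for m n
  proof -
    have neg: "lie (- x) y = - lie x y" "lie x (- y) = - lie x y" for x y :: "S annih"
      unfolding lie_annih_def
      by (rule module_hom.neg[OF clinear_lie_left] module_hom.neg[OF clinear_lie_right])+
    show ?thesis
      unfolding L_def W_def G_def neg S_mode_brackets
      by (simp add: algebra_simps cvec.scale_minus_left cvec.scale_left_diff_distrib scaleC_add_left)
  qed
  ultimately show ?thesis
    using indep unfolding range_b by blast
qed

end
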